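(* Each of Enum MC, Enum Minimal MC and Enum Maximal MC admits a bijective enumeration kernel with $\mathcal O(k^3)$ vertices when the input graph is given together with a clique partition of size at most $k$ (and $k$ is the parameter).
   Context: A clique partition of $G$ is a partition of $V(G)$ into cliques. A matching cut of $G$ is a (possibly empty) edge set $M$ that is a matching and equals $E(A,B)$ (edges between $A$ and $B$) for some partition $\{A,B\}$ of $V(G)$; minimal/maximal are w.r.t. inclusion among matching cuts. Enum MC / Enum Minimal MC / Enum Maximal MC: list all / all minimal / all maximal matching cuts without repetition. For a parameterized enumeration problem (instances $x$, solutions $\mathsf{Sol}(x)$, parameter $\kappa(x)$), a bijective enumeration kernel is a pair of algorithms $\mathcal A,\mathcal A'$ where $\mathcal A$ computes in time polynomial in $|x|+\kappa(x)$ an instance $y$ with $|y|+\kappa(y)\le f(\kappa(x))$ ($f$ computable), and for each $s\in\mathsf{Sol}(y)$, $\mathcal A'$ computes in time polynomial in $|x|+|y|+\kappa(x)+\kappa(y)$ a single solution of $x$, such that this map $\mathsf{Sol}(y)\to\mathsf{Sol}(x)$ is a bijection. Here an instance consists of a graph together with a clique partition of it. *)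

theory Defs
  imports
    "HOL-Library.Disjoint_Sets"
    "HOL-Library.List_Lexorder"
    "HOL-Library.Ramsey"
    "HOL-Computational_Algebra.Polynomial"
begin

section \<open>Model of computation\<close>

text \<open>
  Algorithms are programs of a WHILE language over binary trees in the style of
  N. Jones (in the variant with a single tree-valued store). Every step is charged
  at least the number of nodes of the trees that it reads, copies or creates. Hence
  no value is larger than the time spent on producing it, and the running times
  agree with those of (multitape) Turing machines up to a polynomial.
\<close>

datatype tree = Nl | Pr tree tree

fun tsize :: "tree \<Rightarrow> nat" where
  "tsize Nl = 1"
| "tsize (Pr a b) = Suc (tsize a + tsize b)"

fun hd_tree :: "tree \<Rightarrow> tree" where
  "hd_tree Nl = Nl"
| "hd_tree (Pr a b) = a"

fun tl_tree :: "tree \<Rightarrow> tree" where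
  "tl_tree Nl = Nl"
| "tl_tree (Pr a b) = b"

text \<open>
  The value \<open>Nl\<close> stands for ``false'', every other tree for ``true''. A program maps
  the current tree to a new tree: \<open>CONS p q\<close> runs \<open>p\<close> and \<open>q\<close> on copies of the current
  tree and pairs the results, \<open>EQ\<close> compares the two components of the current tree, and
  in \<open>IF c p q\<close> and \<open>WHILE c p\<close> the test \<open>c\<close> runs on a copy of the current tree.
\<close>

datatype prog =
    ID | NIL | HD | TL | EQ
  | CONS prog prog
  | SEQ prog prog
  | IF prog prog prog
  | WHILE prog prog

text \<open>\<open>exec p a t b\<close>: on input \<open>a\<close>, the program \<open>p\<close> halts with output \<open>b\<close> after time \<open>t\<close>.\<close>

inductive exec :: "prog \<Rightarrow> tree \<Rightarrow> nat \<Rightarrow> tree \<Rightarrow> bool" where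
  exec_ID: "exec ID a (tsize a) a"
| exec_NIL: "exec NIL a (tsize a) Nl"
| exec_HD: "exec HD a (tsize a) (hd_tree a)"
| exec_TL: "exec TL a (tsize a) (tl_tree a)"
| exec_EQ: "exec EQ a (Suc (Suc (tsize a)))
     (if a \<noteq> Nl \<and> hd_tree a = tl_tree a then Pr Nl Nl else Nl)"
| exec_CONS: "exec p a t b \<Longrightarrow> exec q a u c \<Longrightarrow> exec (CONS p q) a (tsize a + t + u + 1) (Pr b c)"
| exec_SEQ: "exec p a t b \<Longrightarrow> exec q b u c \<Longrightarrow> exec (SEQ p q) a (t + u) c"
| exec_IF_true: "exec c a t b \<Longrightarrow> b \<noteq> Nl \<Longrightarrow> exec p a u d \<Longrightarrow> exec (IF c p q) a (tsize a + t + u) d"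
| exec_IF_false: "exec c a t Nl \<Longrightarrow> exec q a u d \<Longrightarrow> exec (IF c p q) a (tsize a + t + u) d"
| exec_WHILE_false: "exec c a t Nl \<Longrightarrow> exec (WHILE c p) a (tsize a + t) a"
| exec_WHILE_true: "exec c a t b \<Longrightarrow> b \<noteq> Nl \<Longrightarrow> exec p a u d \<Longrightarrow> exec (WHILE c p) d v e \<Longrightarrow>
     exec (WHILE c p) a (tsize a + t + u + v) e"

inductive_cases exec_ID_E: "exec ID a t b"
inductive_cases exec_NIL_E: "exec NIL a t b"
inductive_cases exec_HD_E: "exec HD a t b"
inductive_cases exec_TL_E: "exec TL a t b"
inductive_cases exec_EQ_E: "exec EQ a t b"
inductive_cases exec_CONS_E: "exec (CONS p q) a t b"
inductive_cases exec_SEQ_E: "exec (SEQ p q) a t b"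
inductive_cases exec_IF_E: "exec (IF c p q) a t b"
inductive_cases exec_WHILE_E: "exec (WHILE c p) a t b"

lemma exec_deterministic: "exec p a t b \<Longrightarrow> exec p a u c \<Longrightarrow> t = u \<and> b = c"
proof (induction arbitrary: u c rule: exec.induct)
  case exec_ID then show ?case by (auto elim: exec_ID_E)
next
  case exec_NIL then show ?case by (auto elim: exec_NIL_E)
next
  case exec_HD then show ?case by (auto elim: exec_HD_E)
next
  case exec_TL then show ?case by (auto elim: exec_TL_E)
next
  case exec_EQ then show ?case by (elim exec_EQ_E) simp
next
  case exec_CONS
  from exec_CONS.prems show ?case
    by (rule exec_CONS_E) (auto dest!: exec_CONS.IH)
next
  case exec_SEQ
  from exec_SEQ.prems show ?case
    by (rule exec_SEQ_E) (auto dest!: exec_SEQ.IH)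
next
  case exec_IF_true
  from exec_IF_true.prems show ?case
    by (rule exec_IF_E) (auto dest!: exec_IF_true.IH simp: exec_IF_true.hyps)
next
  case exec_IF_false
  from exec_IF_false.prems show ?case
    by (rule exec_IF_E) (auto dest!: exec_IF_false.IH)
next
  case exec_WHILE_false
  from exec_WHILE_false.prems show ?case
    by (rule exec_WHILE_E) (auto dest!: exec_WHILE_false.IH)
next
  case exec_WHILE_true
  from exec_WHILE_true.prems show ?case
    by (rule exec_WHILE_E) (auto dest!: exec_WHILE_true.IH simp: exec_WHILE_true.hyps)
qed

lemma tsize_hd_le: "tsize (hd_tree a) \<le> tsize a" and tsize_tl_le: "tsize (tl_tree a) \<le> tsize a"
  by (cases a; simp)+

lemma tsize_pos: "0 < tsize a"
  by (cases a) simp_all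

lemma exec_output_le_time: "exec p a t b \<Longrightarrow> tsize b \<le> t"
  by (induction rule: exec.induct) (auto simp: tsize_hd_le tsize_tl_le tsize_pos Suc_leI)


section \<open>Encodings\<close>

text \<open>
  Numbers are encoded in unary, so the encoding of a graph on \<open>n\<close> vertices has size
  polynomial in \<open>n\<close>. Finite sets are encoded by their increasing lists of elements
  (lists being ordered lexicographically), so that encodings are unique.
\<close>

fun enc_nat :: "nat \<Rightarrow> tree" where
  "enc_nat 0 = Nl"
| "enc_nat (Suc n) = Pr Nl (enc_nat n)"

fun enc_list :: "('a \<Rightarrow> tree) \<Rightarrow> 'a list \<Rightarrow> tree" where
  "enc_list e [] = Nl"
| "enc_list e (x # xs) = Pr (e x) (enc_list e xs)"

definition enc_family :: "nat set set \<Rightarrow> tree" where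
  "enc_family F =
     enc_list (enc_list enc_nat) (sorted_list_of_set (sorted_list_of_set ` F))"

lemma enc_nat_inj: "enc_nat m = enc_nat n \<Longrightarrow> m = n"
proof (induction m arbitrary: n)
  case 0
  then show ?case by (cases n) auto
next
  case (Suc m)
  then show ?case by (cases n) auto
qed

lemma enc_list_inj:
  assumes "\<And>x y. e x = e y \<Longrightarrow> x = y" and "enc_list e xs = enc_list e ys"
  shows "xs = ys"
  using assms(2)
proof (induction xs arbitrary: ys)
  case Nil
  then show ?case by (cases ys) auto
next
  case (Cons x xs)
  then show ?case by (cases ys) (auto dest: assms(1))
qed

lemma enc_family_inj:
  assumes "finite F" "finite G" "\<forall>A\<in>F \<union> G. finite A" "enc_family F = enc_family G"
  shows "F = G"
proof -
  have "sorted_list_of_set (sorted_list_of_set ` F) = sorted_list_of_set (sorted_list_of_set ` G)"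
    using assms(4) unfolding enc_family_def by (metis enc_list_inj enc_nat_inj)
  then have "sorted_list_of_set ` F = sorted_list_of_set ` G"
    using assms(1,2) by (metis finite_imageI set_sorted_list_of_set)
  moreover have "inj_on sorted_list_of_set (F \<union> G)"
    using assms(3) by (intro inj_onI) (metis set_sorted_list_of_set)
  ultimately show ?thesis
    by (simp add: inj_on_Un_image_eq_iff)
qed

definition computable :: "(nat \<Rightarrow> nat) \<Rightarrow> bool" where
  "computable f \<longleftrightarrow> (\<exists>p. \<forall>n. \<exists>t. exec p (enc_nat n) t (enc_nat (f n)))"


section \<open>Parameterized enumeration problems and bijective kernels\<close>

record ('x, 's) enum_problem =
  instances :: "'x set"
  sols :: "'x \<Rightarrow> 's set"
  param :: "'x \<Rightarrow> nat"
  enc_inst :: "'x \<Rightarrow> tree"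
  enc_sol :: "'s \<Rightarrow> tree"

definition inst_size :: "('x, 's) enum_problem \<Rightarrow> 'x \<Rightarrow> nat" where
  "inst_size Q x = tsize (enc_inst Q x)"

text \<open>
  The map \<open>red\<close> (computed by the first algorithm) sends an instance \<open>x\<close> to the kernel \<open>y\<close>,
  and \<open>lift x\<close> (computed by the second algorithm from \<open>x\<close>, \<open>y\<close> and \<open>s\<close>) sends a
  solution \<open>s\<close> of \<open>y\<close> to a solution of \<open>x\<close>.
\<close>

definition bijective_enum_kernel ::
    "('x, 's) enum_problem \<Rightarrow> ('x \<Rightarrow> 'x) \<Rightarrow> ('x \<Rightarrow> 's \<Rightarrow> 's) \<Rightarrow> bool" where
  "bijective_enum_kernel Q red lift \<longleftrightarrow>
     (\<forall>x\<in>instances Q. red x \<in> instances Q) \<and>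
     (\<exists>p (q :: nat poly). \<forall>x\<in>instances Q.
        \<exists>t \<le> poly q (inst_size Q x + param Q x).
          exec p (enc_inst Q x) t (enc_inst Q (red x))) \<and>
     (\<exists>f. computable f \<and>
        (\<forall>x\<in>instances Q. inst_size Q (red x) + param Q (red x) \<le> f (param Q x))) \<and>
     (\<exists>p (q :: nat poly). \<forall>x\<in>instances Q. \<forall>s\<in>sols Q (red x).
        \<exists>t \<le> poly q (inst_size Q x + inst_size Q (red x) + param Q x + param Q (red x)).
          exec p (Pr (enc_inst Q x) (Pr (enc_inst Q (red x)) (enc_sol Q s))) t
            (enc_sol Q (lift x s))) \<and>
     (\<forall>x\<in>instances Q. bij_betw (lift x) (sols Q (red x)) (sols Q x))"


section \<open>Matching cuts\<close>

definition simple_graph :: "'a set \<Rightarrow> 'a set set \<Rightarrow> bool" where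
  "simple_graph V E \<longleftrightarrow> finite V \<and> (\<forall>e\<in>E. e \<subseteq> V \<and> card e = 2)"

definition clique_partition :: "'a set \<Rightarrow> 'a set set \<Rightarrow> 'a set set \<Rightarrow> bool" where
  "clique_partition V E P \<longleftrightarrow> partition_on V P \<and> (\<forall>K\<in>P. clique K E)"

definition edges_between :: "'a set set \<Rightarrow> 'a set \<Rightarrow> 'a set \<Rightarrow> 'a set set" where
  "edges_between E A B = {e \<in> E. \<exists>a\<in>A. \<exists>b\<in>B. e = {a, b}}"

text \<open>Both sides of a cut are nonempty, as the blocks of any partition are; without
  this, the empty set would be a matching cut of every graph, and the only minimal one.
  A set of edges is a matching iff it is \<open>disjoint\<close>.\<close>

definition matching_cuts :: "'a set \<Rightarrow> 'a set set \<Rightarrow> 'a set set set" where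
  "matching_cuts V E =
     {M. disjoint M \<and> (\<exists>A B. A \<noteq> B \<and> partition_on V {A, B} \<and> M = edges_between E A B)}"

definition minimal_matching_cuts :: "'a set \<Rightarrow> 'a set set \<Rightarrow> 'a set set set" where
  "minimal_matching_cuts V E =
     {M \<in> matching_cuts V E. \<forall>N\<in>matching_cuts V E. N \<subseteq> M \<longrightarrow> N = M}"

definition maximal_matching_cuts :: "'a set \<Rightarrow> 'a set set \<Rightarrow> 'a set set set" where
  "maximal_matching_cuts V E =
     {M \<in> matching_cuts V E. \<forall>N\<in>matching_cuts V E. M \<subseteq> N \<longrightarrow> N = M}"


section \<open>The problems\<close>

text \<open>
  An instance is a graph together with a clique partition of it of size at most the
  parameter \<open>bound\<close>. As usual for encoded inputs, the vertices are \<open>0, \<dots>, n - 1\<close>.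
\<close>

record cp_graph =
  nverts :: nat
  edges :: "nat set set"
  cliques :: "nat set set"
  bound :: nat

definition cp_graphs :: "cp_graph set" where
  "cp_graphs = {x. simple_graph {..<nverts x} (edges x) \<and>
     clique_partition {..<nverts x} (edges x) (cliques x) \<and> card (cliques x) \<le> bound x}"

definition enc_cp_graph :: "cp_graph \<Rightarrow> tree" where
  "enc_cp_graph x = Pr (enc_nat (nverts x)) (Pr (enc_family (edges x))
     (Pr (enc_family (cliques x)) (enc_nat (bound x))))"

definition cp_problem ::
    "(nat set \<Rightarrow> nat set set \<Rightarrow> nat set set set) \<Rightarrow> (cp_graph, nat set set) enum_problem" where
  "cp_problem S = \<lparr>instances = cp_graphs, sols = (\<lambda>x. S {..<nverts x} (edges x)),
     param = bound, enc_inst = enc_cp_graph, enc_sol = enc_family\<rparr>"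

definition Enum_MC :: "(cp_graph, nat set set) enum_problem" where
  "Enum_MC = cp_problem matching_cuts"

definition Enum_Minimal_MC :: "(cp_graph, nat set set) enum_problem" where
  "Enum_Minimal_MC = cp_problem minimal_matching_cuts"

definition Enum_Maximal_MC :: "(cp_graph, nat set set) enum_problem" where
  "Enum_Maximal_MC = cp_problem maximal_matching_cuts"

end

(*
  In a matching cut every clique with at least three vertices lies on one side. Splitting the
  smaller cliques of the given partition into singletons yields at most 2k groups, each
  monochromatic in every matching cut. A colouring of the groups yields a matching cut iff it is not
  constant and avoids all conflicts (S, T, U): a vertex of S with distinct neighbours in T and in U
  (T = U allowed) forbids that S differs from both T and U. The cut edges are determined by the
  pairs of adjacent groups that are separated, and conversely. So the inclusion order on matching
  cuts depends only on the adjacencies and conflicts of the groups, and the kernel realises the same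
  adjacencies and conflicts by 4 m^2 vertices in each of its m <= 2k cliques.

  For the running times, both algorithms are written as comprehensions over lists. Such programs
  are polynomial by composition, since no loop feeds its own output back into the computation.
*)

theory Submission
  imports Defs
begin


section \<open>Polynomial time\<close>

text \<open>A cut does not determine the colouring: exchanging the two colours, or flipping one
  connected component, can leave the set of cut edges unchanged. The bijection therefore runs
  through the sets of separated pairs of adjacent groups and never chooses a colouring. A conflict
  is a triple of groups, which is where the cube comes from: every triple gets its own vertices, in
  four roles. The obstacle is that edges realising one conflict must not combine with others into a
  conflict that the input does not have. Hence no gadget vertex is shared. The centre of a gadget
  (role 0) is the only vertex with two neighbours in other cliques; its two neighbours (roles 1 and
  2) have no further ones, and they are different vertices even if T = U. Role 3 realises the
  adjacencies, which need not take part in any conflict. Every time bound is proved for all trees,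
  whether or not they encode an instance. Loops must therefore stay under control on arbitrary
  stores, and a store without the expected shape must stop at once.\<close>

lemma poly_nat_mono: "m \<le> n \<Longrightarrow> poly q m \<le> poly q n" for q :: "nat poly"
  by (induction q) (auto intro!: mult_le_mono)

text \<open>Only the existence of a polynomial is recorded, so time bounds can be assembled from
  sums, products and compositions without computing coefficients.\<close>

definition poly_bounded :: "(tree \<Rightarrow> nat) \<Rightarrow> bool" where
  "poly_bounded h \<longleftrightarrow> (\<exists>q :: nat poly. \<forall>a. h a \<le> poly q (tsize a))"

lemma poly_bounded_mono: "poly_bounded h \<Longrightarrow> (\<And>a. h' a \<le> h a)
    \<Longrightarrow> poly_bounded h'"
  unfolding poly_bounded_def by (meson le_trans)

lemma poly_bounded_const: "poly_bounded (\<lambda>a. n)"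
  unfolding poly_bounded_def by (rule exI[of _ "[:n:]"]) simp

lemma poly_bounded_tsize: "poly_bounded tsize"
  unfolding poly_bounded_def by (rule exI[of _ "[:0, 1:]"]) simp

lemma poly_bounded_add:
  assumes "poly_bounded h" "poly_bounded h'"
  shows "poly_bounded (\<lambda>a. h a + h' a)"
proof -
  obtain q q' where "\<forall>a. h a \<le> poly q (tsize a)" "\<forall>a. h' a \<le> poly q' (tsize a)"
    using assms unfolding poly_bounded_def by auto
  then show ?thesis unfolding poly_bounded_def
    by (intro exI[of _ "q + q'"]) (auto intro: add_mono)
qed

lemma poly_bounded_mult:
  assumes "poly_bounded h" "poly_bounded h'"
  shows "poly_bounded (\<lambda>a. h a * h' a)"
proof -
  obtain q q' where "\<forall>a. h a \<le> poly q (tsize a)" "\<forall>a. h' a \<le> poly q' (tsize a)"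
    using assms unfolding poly_bounded_def by auto
  then show ?thesis unfolding poly_bounded_def
    by (intro exI[of _ "q * q'"]) (auto intro: mult_le_mono)
qed

lemma poly_bounded_poly:
  assumes "poly_bounded h"
  shows "poly_bounded (\<lambda>a. poly q (h a))"
proof -
  obtain r where "\<forall>a. h a \<le> poly r (tsize a)"
    using assms unfolding poly_bounded_def by auto
  then show ?thesis unfolding poly_bounded_def
    by (intro exI[of _ "pcompose q r"]) (auto simp: poly_pcompose intro: poly_nat_mono)
qed

lemmas poly_bounded_intros =
  poly_bounded_const poly_bounded_tsize poly_bounded_add poly_bounded_mult poly_bounded_poly

text \<open>Halting within the bound is required on every tree. This total form makes composition
  unconditional, and claims about encodings follow by specialisation.\<close>

definition ptime :: "(tree \<Rightarrow> tree) \<Rightarrow> bool" where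
  "ptime f \<longleftrightarrow> (\<exists>p (q :: nat poly). \<forall>a. \<exists>t \<le> poly q
      (tsize a). exec p a t (f a))"

lemma ptimeI:
  assumes "poly_bounded h" "\<And>a. \<exists>t \<le> h a. exec p a t (f a)"
  shows "ptime f"
  using assms unfolding ptime_def poly_bounded_def by (meson le_trans)

text \<open>The output of a run has at most as many nodes as the run takes time, so a time bound
  also bounds the size of the result.\<close>

lemma ptime_tsize_bound:
  assumes "ptime f"
  obtains q where "\<And>a. tsize (f a) \<le> poly q (tsize a)"
  using assms unfolding ptime_def by (meson exec_output_le_time le_trans)

lemma ptime_id: "ptime (\<lambda>a. a)"
  by (rule ptimeI[of tsize ID]) (auto intro: exec_ID poly_bounded_intros)

lemma ptime_Nl: "ptime (\<lambda>a. Nl)"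
  by (rule ptimeI[of tsize NIL]) (auto intro: exec_NIL poly_bounded_intros)

text \<open>The outer program runs on an intermediate result whose size is at most the time of the
  inner one; since polynomials over the naturals are monotone, one bound can be substituted into the
  other.\<close>

lemma ptime_comp:
  assumes "ptime f" "ptime g"
  shows "ptime (\<lambda>a. f (g a))"
proof -
  obtain p q where p: "\<And>a. \<exists>t \<le> poly q (tsize a). exec p a t (f a)"
    using assms(1) unfolding ptime_def by blast
  obtain p' q' where p': "\<And>a. \<exists>t \<le> poly q' (tsize a). exec p' a t (g a)"
    using assms(2) unfolding ptime_def by blast
  show ?thesis
  proof (rule ptimeI[where p = "SEQ p' p"])
    show "poly_bounded (\<lambda>a. poly q' (tsize a) + poly q (poly q' (tsize a)))"
      by (intro poly_bounded_intros)
    fix a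
    obtain t where t: "t \<le> poly q' (tsize a)" "exec p' a t (g a)"
      using p' by blast
    obtain u where u: "u \<le> poly q (tsize (g a))" "exec p (g a) u (f (g a))"
      using p by blast
    have "u \<le> poly q (poly q' (tsize a))"
      using u(1) t exec_output_le_time poly_nat_mono by (meson le_trans)
    then show "\<exists>t\<le>poly q' (tsize a) + poly q (poly q' (tsize a)). exec (SEQ p' p) a t (f (g a))"
      using t u exec_SEQ by (intro exI[of _ "t + u"]) auto
  qed
qed

lemma ptime_hd: "ptime f \<Longrightarrow> ptime (\<lambda>a. hd_tree (f a))"
  by (rule ptime_comp, rule ptimeI[of tsize HD]) (auto intro: exec_HD poly_bounded_intros)

lemma ptime_tl: "ptime f \<Longrightarrow> ptime (\<lambda>a. tl_tree (f a))"
  by (rule ptime_comp, rule ptimeI[of tsize TL]) (auto intro: exec_TL poly_bounded_intros)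

lemma ptime_Pr:
  assumes "ptime f" "ptime g"
  shows "ptime (\<lambda>a. Pr (f a) (g a))"
proof -
  obtain p q where p: "\<And>a. \<exists>t \<le> poly q (tsize a). exec p a t (f a)"
    using assms(1) unfolding ptime_def by blast
  obtain p' q' where p': "\<And>a. \<exists>t \<le> poly q' (tsize a). exec p' a t (g a)"
    using assms(2) unfolding ptime_def by blast
  show ?thesis
  proof (rule ptimeI[where p = "CONS p p'"])
    show "poly_bounded (\<lambda>a. tsize a + poly q (tsize a) + poly q' (tsize a) + 1)"
      by (intro poly_bounded_intros)
    fix a
    obtain t where t: "t \<le> poly q (tsize a)" "exec p a t (f a)"
      using p by blast
    obtain u where u: "u \<le> poly q' (tsize a)" "exec p' a u (g a)"
      using p' by blast
    show "\<exists>t\<le>tsize a + poly q (tsize a) + poly q' (tsize a) + 1. exec (CONS p p') a t (Pr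
        (f a) (g a))"
      using t u exec_CONS[OF t(2) u(2)] by (intro exI[of _ "tsize a + t + u + 1"]) auto
  qed
qed

lemma ptime_const: "ptime (\<lambda>a. c)"
  by (induction c) (auto intro: ptime_Nl ptime_Pr)

definition tree_of_bool :: "bool \<Rightarrow> tree" where
  "tree_of_bool b = (if b then Pr Nl Nl else Nl)"

abbreviation pdecidable :: "(tree \<Rightarrow> bool) \<Rightarrow> bool" where
  "pdecidable P \<equiv> ptime (\<lambda>a. tree_of_bool (P a))"

lemma tree_of_bool_eq_Nl [simp]: "tree_of_bool b = Nl \<longleftrightarrow> \<not> b"
  by (simp add: tree_of_bool_def)

lemma pdecidable_eq:
  assumes "ptime f" "ptime g"
  shows "pdecidable (\<lambda>a. f a = g a)"
proof -
  define e where "e = (\<lambda>a. if a \<noteq> Nl \<and> hd_tree a = tl_tree a then Pr Nl Nl else Nl)"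
  have "ptime e" unfolding e_def
  proof (rule ptimeI)
    show "poly_bounded (\<lambda>a. tsize a + 2)"
      by (intro poly_bounded_intros)
    show "\<exists>t\<le>tsize a + 2. exec EQ a t (if a \<noteq> Nl \<and>
        hd_tree a = tl_tree a then Pr Nl Nl else Nl)" for a
      using exec_EQ[of a] by (intro exI[of _ "Suc (Suc (tsize a))"]) simp
  qed
  then have "ptime (\<lambda>a. e (Pr (f a) (g a)))"
    by (rule ptime_comp) (intro ptime_Pr assms)
  then show ?thesis
    by (simp add: e_def tree_of_bool_def)
qed

lemma ptime_If_nonNl:
  assumes "ptime c" "ptime f" "ptime g"
  shows "ptime (\<lambda>a. if c a \<noteq> Nl then f a else g a)"
proof -
  obtain pc qc where c: "\<And>a. \<exists>t \<le> poly qc (tsize a). exec pc a t (c a)"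
    using assms(1) unfolding ptime_def by blast
  obtain p q where p: "\<And>a. \<exists>t \<le> poly q (tsize a). exec p a t (f a)"
    using assms(2) unfolding ptime_def by blast
  obtain p' q' where p': "\<And>a. \<exists>t \<le> poly q' (tsize a). exec p' a t (g a)"
    using assms(3) unfolding ptime_def by blast
  show ?thesis
  proof (rule ptimeI[where p = "IF pc p p'"])
    show "poly_bounded (\<lambda>a. tsize a + poly qc (tsize a) + (poly q (tsize a) + poly q' (tsize a)))"
      by (intro poly_bounded_intros)
    fix a
    obtain s where s: "s \<le> poly qc (tsize a)" "exec pc a s (c a)"
      using c by blast
    obtain t where t: "t \<le> poly q (tsize a)" "exec p a t (f a)"
      using p by blast
    obtain u where u: "u \<le> poly q' (tsize a)" "exec p' a u (g a)"
      using p' by blast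
    show "\<exists>t\<le>tsize a + poly qc (tsize a) + (poly q (tsize a) + poly q' (tsize a)).
        exec (IF pc p p') a t (if c a \<noteq> Nl then f a else g a)"
    proof (cases "c a = Nl")
      case True
      then show ?thesis
        using s t u exec_IF_false[of pc a s p' u] by (intro exI[of _ "tsize a + s + u"]) auto
    next
      case False
      then show ?thesis
        using s t u exec_IF_true[of pc a s "c a" p t] by (intro exI[of _ "tsize a + s + t"]) auto
    qed
  qed
qed

lemma ptime_If: "pdecidable P \<Longrightarrow> ptime f \<Longrightarrow> ptime g \<Longrightarrow>
    ptime (\<lambda>a. if P a then f a else g a)"
  using ptime_If_nonNl[of "\<lambda>a. tree_of_bool (P a)" f g] by simp

lemma pdecidable_not: "pdecidable P \<Longrightarrow> pdecidable (\<lambda>a. \<not> P a)"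
  using ptime_If[of P "\<lambda>_. tree_of_bool False"
      "\<lambda>_. tree_of_bool True", OF _ ptime_const ptime_const]
  by (rule back_subst[of ptime]) (auto simp: tree_of_bool_def)

lemma pdecidable_conj: "pdecidable P \<Longrightarrow> pdecidable Q \<Longrightarrow>
    pdecidable (\<lambda>a. P a \<and> Q a)"
  using ptime_If[of P "\<lambda>a. tree_of_bool (Q a)" "\<lambda>_. Nl", OF _ _ ptime_Nl]
  by (rule back_subst[of ptime]) (auto simp: tree_of_bool_def)

lemma pdecidable_disj: "pdecidable P \<Longrightarrow> pdecidable Q \<Longrightarrow>
    pdecidable (\<lambda>a. P a \<or> Q a)"
  using pdecidable_not[OF pdecidable_conj[OF pdecidable_not pdecidable_not], of P Q] by simp

text \<open>Polynomially many rounds of a polynomial-time body are not enough by themselves: a body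
  that doubles its store would reach exponential size. The separate bound \<open>B\<close> on all
  intermediate stores excludes this, and every use of the rule has to supply it.\<close>

lemma ptime_while:
  assumes "ptime c" "ptime b"
    and stop: "\<And>a. c ((b ^^ N a) a) = Nl"
    and continue: "\<And>a i. i < N a \<Longrightarrow> c ((b ^^ i) a) \<noteq> Nl"
    and N: "poly_bounded N"
    and size: "poly_bounded B" "\<And>a i. i \<le> N a \<Longrightarrow> tsize ((b ^^ i) a) \<le> B a"
  shows "ptime (\<lambda>a. (b ^^ N a) a)"
proof -
  obtain pc qc where c: "\<And>a. \<exists>t \<le> poly qc (tsize a). exec pc a t (c a)"
    using assms(1) unfolding ptime_def by blast
  obtain p q where p: "\<And>a. \<exists>t \<le> poly q (tsize a). exec p a t (b a)"
    using assms(2) unfolding ptime_def by blast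
  \<comment> \<open>Cost of one round: copying the store, evaluating the test and running the body,
    each on a store of size at most \<open>B a\<close>.\<close>
  define R where "R = (\<lambda>a. B a + poly qc (B a) + poly q (B a))"
  \<comment> \<open>Here \<open>i\<close> counts the rounds still to come. The induction thus starts
    at the failing test and matches the way \<open>exec_WHILE_true\<close> unfolds a loop from the
    front.\<close>
  have loop: "\<exists>t \<le> Suc i * R a. exec (WHILE pc p) ((b ^^ (N a - i)) a) t ((b ^^ N a) a)"
    if "i \<le> N a" for a i
    using that
  proof (induction i)
    case 0
    obtain s where s: "s \<le> poly qc (tsize ((b ^^ N a) a))" "exec pc ((b ^^ N a) a) s Nl"
      using c stop by metis
    moreover have "tsize ((b ^^ N a) a) \<le> B a"
      by (simp add: size(2))
    moreover from this have "poly qc (tsize ((b ^^ N a) a)) \<le> poly qc (B a)"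
      by (rule poly_nat_mono)
    ultimately show ?case
      using exec_WHILE_false[OF s(2), of p]
      by (intro exI[of _ "tsize ((b ^^ N a) a) + s"]) (auto simp: R_def)
  next
    case (Suc i)
    let ?d = "(b ^^ (N a - Suc i)) a"
    have next_state: "b ?d = (b ^^ (N a - i)) a"
      using Suc.prems by (metis Suc_diff_Suc Suc_le_lessD comp_apply funpow.simps(2))
    have d: "tsize ?d \<le> B a"
      by (rule size(2)) simp
    obtain s where s: "s \<le> poly qc (tsize ?d)" "exec pc ?d s (c ?d)"
      using c by blast
    obtain u where u: "u \<le> poly q (tsize ?d)" "exec p ?d u (b ?d)"
      using p by blast
    obtain v where v: "v \<le> Suc i * R a" "exec (WHILE pc p) (b ?d) v ((b ^^ N a) a)"
      using Suc next_state by auto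
    have "exec (WHILE pc p) ?d (tsize ?d + s + u + v) ((b ^^ N a) a)"
      using s(2) continue Suc.prems u(2) v(2) by (intro exec_WHILE_true) auto
    moreover have "tsize ?d + s + u + v \<le> Suc (Suc i) * R a"
      using d s(1) u(1) v(1) poly_nat_mono[OF d, of qc] poly_nat_mono[OF d, of q]
      by (auto simp: R_def)
    ultimately show ?case by blast
  qed
  show ?thesis
  proof (rule ptimeI)
    show "poly_bounded (\<lambda>a. (1 + N a) * R a)"
      unfolding R_def by (intro poly_bounded_intros N size(1))
    show "\<exists>t\<le>(1 + N a) * R a. exec (WHILE pc p) a t ((b ^^ N a) a)" for a
      using loop[of "N a" a] by simp
  qed
qed

section \<open>Lists as trees, and the basic loops over them\<close>

fun list_of_tree :: "tree \<Rightarrow> tree list" where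
  "list_of_tree Nl = []"
| "list_of_tree (Pr a b) = a # list_of_tree b"

abbreviation tree_of_list :: "tree list \<Rightarrow> tree" where
  "tree_of_list \<equiv> enc_list (\<lambda>a. a)"

lemma list_of_enc_list [simp]: "list_of_tree (enc_list e xs) = map e xs"
  by (induction xs) auto

text \<open>Every tree is a list along its right spine, so trees and lists of trees correspond one
  to one and list operations need no validity check on their arguments.\<close>

lemma tree_of_list_of_tree [simp]: "tree_of_list (list_of_tree a) = a"
  by (induction a) auto

lemma enc_list_conv_map: "enc_list e xs = tree_of_list (map e xs)"
  by (induction xs) auto

lemma list_of_enc_nat [simp]: "list_of_tree (enc_nat n) = replicate n Nl"
  by (induction n) auto

lemma tree_of_replicate: "tree_of_list (replicate n Nl) = enc_nat n"
  by (induction n) auto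

lemma list_of_tree_eq_Nil [simp]: "list_of_tree a = [] \<longleftrightarrow> a = Nl"
  by (cases a) auto

lemma tsize_enc_nat [simp]: "tsize (enc_nat n) = 2 * n + 1"
  by (induction n) auto

lemma tsize_enc_list: "tsize (enc_list e xs) = 1 + (\<Sum>x\<leftarrow>xs. 1 + tsize (e x))"
  by (induction xs) auto

lemma length_list_of_tree_le: "length (list_of_tree a) \<le> tsize a"
  by (induction a) auto

lemma tsize_nth_list_of_tree: "i < length (list_of_tree a) \<Longrightarrow>
    tsize (list_of_tree a ! i) \<le> tsize a"
  by (induction a arbitrary: i) (auto simp: nth_Cons le_SucI trans_le_add2 trans_le_add1 split: nat.splits)

text \<open>Entries move one at a time from the front of one list to the front of the other. The
  store is a pair of lists whose joint size stays constant, so the size condition of the loop rule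
  is met by the input itself.\<close>

lemma ptime_rev_append:
  assumes "ptime f" "ptime g"
  shows "ptime (\<lambda>a. tree_of_list (rev (list_of_tree (f a)) @ list_of_tree (g a)))"
proof -
  define b where "b = (\<lambda>s. Pr (tl_tree (hd_tree s)) (Pr (hd_tree (hd_tree s)) (tl_tree s)))"
  have iter: "(b ^^ i) (Pr x y) = Pr (tree_of_list (drop i (list_of_tree x)))
      (tree_of_list (rev (take i (list_of_tree x)) @ list_of_tree y))"
    if "i \<le> length (list_of_tree x)" for i x y
    using that
  proof (induction i)
    case (Suc i)
    then show ?case
      by (simp add: b_def take_Suc_conv_app_nth Cons_nth_drop_Suc[symmetric])
  qed simp
  define N where "N = (\<lambda>a. length (list_of_tree (hd_tree a)))"
  \<comment> \<open>A loop started on \<open>Nl\<close> makes no round; any other tree is a pair and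
    hence a store of the intended shape.\<close>
  have iter': "a \<noteq> Nl \<Longrightarrow> i \<le> N a \<Longrightarrow>
      (b ^^ i) a = Pr (tree_of_list (drop i (list_of_tree (hd_tree a))))
      (tree_of_list (rev (take i (list_of_tree (hd_tree a))) @ list_of_tree (tl_tree a)))" for i a
    by (cases a) (auto simp: N_def iter)
  have continue: "hd_tree ((b ^^ i) a) \<noteq> Nl" if "i < N a" for a i
  proof -
    have "a \<noteq> Nl" using that by (auto simp: N_def)
    moreover have "drop i (list_of_tree (hd_tree a)) \<noteq> []"
      using that by (simp add: N_def)
    then have "tree_of_list (drop i (list_of_tree (hd_tree a))) \<noteq> Nl"
      by (metis enc_list.simps list.exhaust tree.distinct(1))
    ultimately show ?thesis
      using that by (simp add: iter')
  qed
  have "ptime (\<lambda>a. (b ^^ N a) a)"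
  proof (rule ptime_while)
    show "ptime hd_tree"
      by (intro ptime_hd ptime_id)
    show "ptime b"
      unfolding b_def by (intro ptime_hd ptime_tl ptime_Pr ptime_id)
    show "hd_tree ((b ^^ N a) a) = Nl" for a
      by (cases "a = Nl") (simp add: N_def, simp add: iter' N_def)
    show "hd_tree ((b ^^ i) a) \<noteq> Nl" if "i < N a" for a i
      using that by (rule continue)
    show "poly_bounded N"
      unfolding N_def using length_list_of_tree_le tsize_hd_le
      by (intro poly_bounded_mono[OF poly_bounded_tsize]) (rule le_trans)
    show "poly_bounded tsize" by (rule poly_bounded_tsize)
    show "tsize ((b ^^ i) a) \<le> tsize a" if "i \<le> N a" for a i
      using that
    proof (induction i)
      case (Suc i)
      have "tsize (b s) = tsize s" if "hd_tree s \<noteq> Nl" for s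
        using that by (cases s rule: hd_tree.cases; cases "hd_tree s") (auto simp: b_def)
      with Suc continue[of i a] show ?case
        by simp
    qed simp
  qed
  then have "ptime (\<lambda>a. tl_tree ((b ^^ N (Pr (f a) (g a))) (Pr (f a) (g a))))"
    using ptime_comp[of "\<lambda>a. (b ^^ N a) a" "\<lambda>a. Pr (f a) (g a)"] ptime_Pr[OF assms]
    by (intro ptime_tl) simp
  then show ?thesis
    by (simp add: iter N_def)
qed


text \<open>Reverse the first list onto the empty one, then reverse the result onto the second
  list.\<close>

lemma ptime_append:
  assumes "ptime (\<lambda>a. tree_of_list (f a))" "ptime (\<lambda>a. tree_of_list (g a))"
  shows "ptime (\<lambda>a. tree_of_list (f a @ g a))"
  using ptime_rev_append[OF ptime_rev_append[OF assms(1) ptime_Nl] assms(2)] by simp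

text \<open>Two lists end in one \<open>Nl\<close> each, their concatenation in a single
  one.\<close>

lemma tsize_tree_of_list_append:
  "tsize (tree_of_list (xs @ ys)) + 1 = tsize (tree_of_list xs) + tsize (tree_of_list ys)"
  by (induction xs) auto

lemma tsize_tree_of_list_drop: "tsize (tree_of_list (drop n xs)) \<le> tsize (tree_of_list xs)"
  using tsize_tree_of_list_append[of "take n xs" "drop n xs"] tsize_pos[of "tree_of_list (take n xs)"]
  by simp

lemma tsize_tree_of_list_concat:
  assumes "\<And>j. j < i \<Longrightarrow> tsize (tree_of_list (F j)) \<le> C"
  shows "tsize (tree_of_list (concat (map F [0..<i]))) \<le> 1 + i * C"
  using assms
proof (induction i)
  case (Suc i)
  then have "tsize (tree_of_list (concat (map F [0..<i]))) \<le> 1 + i * C"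
    "tsize (tree_of_list (F i)) \<le> C"
    by auto
  then show ?case
    using tsize_tree_of_list_append[of "concat (map F [0..<i])" "F i"] by simp
qed simp

lemma enc_nat_conv_funpow: "enc_nat n = (Pr Nl ^^ n) Nl"
  by (induction n) auto

lemma tsize_funpow_Pr_Nl: "tsize ((Pr Nl ^^ n) a) = 2 * n + tsize a"
  by (induction n) auto

text \<open>Since the loop body reads only the environment, the index and the current element but not
  the output produced so far, the output cannot grow by more than a polynomial.\<close>

lemma ptime_concat_index:
  assumes X: "ptime (\<lambda>a. tree_of_list (X a))"
    and G: "ptime (\<lambda>z. tree_of_list (G (hd_tree z) (hd_tree (tl_tree z)) (tl_tree (tl_tree z))))"
  shows "ptime (\<lambda>a. tree_of_list (concat (map (\<lambda>i. G a (enc_nat i) (X a ! i))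
      [0..<length (X a)])))"
proof -
  define g where "g = (\<lambda>z. G (hd_tree z) (hd_tree (tl_tree z)) (tl_tree (tl_tree z)))"
  have g: "ptime (\<lambda>z. tree_of_list (g z))"
    using G unfolding g_def .
  define todo where "todo = (\<lambda>s. hd_tree (tl_tree (tl_tree s)))"
  \<comment> \<open>The store nests environment, counter, remaining list and output. The function
    \<open>g\<close> receives the first two and the head of the remaining list, never the
    output.\<close>
  define b where "b = (\<lambda>s. Pr (hd_tree s) (Pr (Pr Nl (hd_tree (tl_tree s))) (Pr (tl_tree (todo s))
    (tree_of_list (list_of_tree (tl_tree (tl_tree (tl_tree s))) @
      g (Pr (hd_tree s) (Pr (hd_tree (tl_tree s)) (hd_tree (todo s)))))))))"
  \<comment> \<open>The counter starts from an arbitrary tree \<open>c\<close>, because the loop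
    rule speaks about every store. In the intended run \<open>c\<close> is \<open>Nl\<close>, and
    the counter is then a unary number.\<close>
  define out where "out = (\<lambda>e c xs i. concat (map (\<lambda>j. g (Pr e (Pr ((Pr Nl ^^ j) c)
      (xs ! j)))) [0..<i]))"
  define N where "N = (\<lambda>s. length (list_of_tree (todo s)))"
  have iter: "(b ^^ i) (Pr e (Pr c (Pr x y))) = Pr e (Pr ((Pr Nl ^^ i) c)
      (Pr (tree_of_list (drop i (list_of_tree x))) (tree_of_list (list_of_tree y @ out e c
          (list_of_tree x) i))))"
    if "i \<le> length (list_of_tree x)" for i e c x y
    using that
  proof (induction i)
    case (Suc i)
    then show ?case
      by (simp add: b_def todo_def out_def Cons_nth_drop_Suc[symmetric])
  qed (simp add: out_def)
  \<comment> \<open>A single round already needs a nonempty list below two pairs, which forces the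
    intended shape; all other trees stop at once.\<close>
  have N_pos: "\<exists>e c x y. s = Pr e (Pr c (Pr x y))" if "0 < N s" for s
  proof -
    have "\<exists>u v. t = Pr u v" if "t \<noteq> Nl" for t
      using that by (cases t) auto
    moreover have "tl_tree (tl_tree s) \<noteq> Nl" "tl_tree s \<noteq> Nl" "s \<noteq> Nl"
      using that by (auto simp: N_def todo_def)
    ultimately show ?thesis
      by (metis tl_tree.simps(2))
  qed
  have continue: "todo ((b ^^ i) s) \<noteq> Nl" if i: "i < N s" for s i
  proof -
    obtain e c x y where s: "s = Pr e (Pr c (Pr x y))"
      using N_pos i by (metis gr_zeroI not_less_zero)
    have "drop i (list_of_tree x) \<noteq> []"
      using i by (simp add: N_def todo_def s)
    then have "tree_of_list (drop i (list_of_tree x)) \<noteq> Nl"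
      by (metis enc_list.simps list.exhaust tree.distinct(1))
    then show ?thesis
      using i by (simp add: s iter todo_def N_def)
  qed
  obtain q :: "nat poly" where q: "\<And>z. tsize (tree_of_list (g z)) \<le> poly q (tsize z)"
    using ptime_tsize_bound[OF g] by blast
  have "ptime (\<lambda>s. (b ^^ N s) s)"
  proof (rule ptime_while)
    show "ptime todo"
      unfolding todo_def by (intro ptime_hd ptime_tl ptime_id)
    have "ptime (\<lambda>s. tree_of_list (g (Pr (hd_tree s) (Pr (hd_tree (tl_tree s)) (hd_tree (todo s))))))"
      by (rule ptime_comp[OF g, of "\<lambda>s. Pr (hd_tree s) (Pr (hd_tree (tl_tree s)) (hd_tree
          (todo s)))"]) (unfold todo_def, intro ptime_hd ptime_tl ptime_Pr ptime_id)
    then have "ptime (\<lambda>s. tree_of_list (list_of_tree (tl_tree (tl_tree (tl_tree s))) @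
        g (Pr (hd_tree s) (Pr (hd_tree (tl_tree s)) (hd_tree (todo s))))))"
      by (rule ptime_append[rotated]) (simp, intro ptime_tl ptime_id)
    then show "ptime b"
      unfolding b_def todo_def by (intro ptime_hd ptime_tl ptime_Pr ptime_id ptime_Nl)
    show "todo ((b ^^ N s) s) = Nl" for s
    proof (cases "N s = 0")
      case True
      then show ?thesis by (simp add: N_def)
    next
      case False
      then obtain e c x y where s: "s = Pr e (Pr c (Pr x y))"
        using N_pos[of s] by blast
      show ?thesis by (simp add: s N_def todo_def iter)
    qed
    show "todo ((b ^^ i) s) \<noteq> Nl" if "i < N s" for s i
      using that by (rule continue)
    have N_le: "N s \<le> tsize s" for s
      unfolding N_def todo_def
      by (meson le_trans length_list_of_tree_le tsize_hd_le tsize_tl_le)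
    then show "poly_bounded N"
      by (rule poly_bounded_mono[OF poly_bounded_tsize])
    \<comment> \<open>The factor 10 is generous. An argument of \<open>g\<close> consists of the
      environment, one element and a counter that has grown by at most \<open>2 * tsize s\<close>;
      the whole store without the new output fits into the same bound. The product bounds the new
      output, with at most \<open>tsize s\<close> rounds.\<close>
    show "poly_bounded (\<lambda>s. 10 * tsize s + tsize s * poly q (10 * tsize s))"
      by (intro poly_bounded_intros)
    show "tsize ((b ^^ i) s) \<le> 10 * tsize s + tsize s * poly q (10 * tsize s)" if i: "i \<le> N s" for s i
    proof (cases "N s = 0")
      case True
      then show ?thesis using i by simp
    next
      case False
      then obtain e c x y where s: "s = Pr e (Pr c (Pr x y))"
        using N_pos[of s] by blast
      define xs where "xs = list_of_tree x"
      have x: "x = tree_of_list xs" by (simp add: xs_def)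
      have N: "N s = length xs" by (simp add: N_def s todo_def xs_def)
      have i_le: "i \<le> tsize s" using i N_le[of s] by simp
      have "tsize (tree_of_list (g (Pr e (Pr ((Pr Nl ^^ j) c) (xs ! j))))) \<le> poly q (10 * tsize s)"
        if "j < i" for j
      proof -
        have "tsize (xs ! j) \<le> tsize x"
          unfolding xs_def using that i by (intro tsize_nth_list_of_tree) (simp add: N xs_def)
        moreover have "j \<le> tsize s" using that i_le by simp
        ultimately have "tsize (Pr e (Pr ((Pr Nl ^^ j) c) (xs ! j))) \<le> 10 * tsize s"
          by (simp add: tsize_funpow_Pr_Nl s)
        then show ?thesis
          using q poly_nat_mono by (meson le_trans)
      qed
      then have "tsize (tree_of_list (out e c xs i)) \<le> 1 + i * poly q (10 * tsize s)"
        unfolding out_def by (rule tsize_tree_of_list_concat)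
      also have "\<dots> \<le> 1 + tsize s * poly q (10 * tsize s)"
        using i_le by simp
      finally have "tsize (tree_of_list (list_of_tree y @ out e c xs i)) \<le> tsize y + tsize s *
          poly q (10 * tsize s)"
        using tsize_tree_of_list_append[of "list_of_tree y" "out e c xs i"] by simp
      moreover have "tsize (tree_of_list (drop i xs)) \<le> tsize x"
        using tsize_tree_of_list_drop[of i xs] by (simp add: x)
      moreover have "tsize ((Pr Nl ^^ i) c) \<le> 2 * tsize s + tsize c"
        using i_le by (simp add: tsize_funpow_Pr_Nl)
      moreover have "(b ^^ i) s = Pr e (Pr ((Pr Nl ^^ i) c)
          (Pr (tree_of_list (drop i xs)) (tree_of_list (list_of_tree y @ out e c xs i))))"
        using i by (simp add: s iter xs_def N_def todo_def)
      moreover have "tsize s = 3 + tsize e + tsize c + tsize x + tsize y"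
        by (simp add: s)
      ultimately show ?thesis
        by simp
    qed
  qed
  moreover have "ptime (\<lambda>a. Pr a (Pr Nl (Pr (tree_of_list (X a)) Nl)))"
    by (intro ptime_Pr ptime_id ptime_Nl X)
  ultimately have "ptime (\<lambda>a. (\<lambda>s. (b ^^ N s) s) (Pr a (Pr Nl (Pr (tree_of_list (X a)) Nl))))"
    by (rule ptime_comp[of "\<lambda>s. (b ^^ N s) s"
        "\<lambda>a. Pr a (Pr Nl (Pr (tree_of_list (X a)) Nl))"])
  then have "ptime (\<lambda>a. tl_tree (tl_tree (tl_tree ((\<lambda>s. (b ^^ N s) s) (Pr a (Pr Nl
      (Pr (tree_of_list (X a)) Nl)))))))"
    by (intro ptime_tl)
  then show ?thesis
    by (simp add: N_def todo_def iter out_def g_def enc_nat_conv_funpow)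
qed

section \<open>Comprehensions and bounded search in polynomial time\<close>

lemma ptime_list_const: "ptime (\<lambda>a. tree_of_list xs)"
  by (rule ptime_const)

lemma ptime_list_of_tree: "ptime f \<Longrightarrow> ptime (\<lambda>a. tree_of_list (list_of_tree (f a)))"
  by simp

lemma ptime_list_single: "ptime f \<Longrightarrow> ptime (\<lambda>a. tree_of_list [f a])"
  by (simp add: ptime_Pr ptime_Nl)

lemma ptime_list_If:
  assumes "pdecidable P" "ptime (\<lambda>a. tree_of_list (f a))" "ptime (\<lambda>a. tree_of_list (g a))"
  shows "ptime (\<lambda>a. tree_of_list (if P a then f a else g a))"
  using ptime_If[OF assms] by (rule back_subst[of ptime]) auto

lemma concat_map_index: "concat (map (\<lambda>i. f (xs ! i)) [0..<length xs]) = concat (map f xs)"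
  by (metis (no_types, lifting) map_cong map_map map_nth comp_apply)

text \<open>The loop hands its body the tree \<open>Pr a (Pr i x)\<close> of environment, index and
  element. A body that ignores the index finds \<open>a\<close> at \<open>hd_tree z\<close> and
  \<open>x\<close> at \<open>tl_tree (tl_tree z)\<close>; the premises of the later combinators have
  the same shape.\<close>

lemma ptime_concat:
  assumes X: "ptime (\<lambda>a. tree_of_list (X a))"
    and G: "ptime (\<lambda>z. tree_of_list (G (hd_tree z) (tl_tree (tl_tree z))))"
  shows "ptime (\<lambda>a. tree_of_list (concat (map (G a) (X a))))"
  using ptime_concat_index[OF X, of "\<lambda>a i x. G a x"] G
  by (simp add: concat_map_index)

lemma ptime_map:
  assumes X: "ptime (\<lambda>a. tree_of_list (X a))"
    and G: "ptime (\<lambda>z. G (hd_tree z) (tl_tree (tl_tree z)))"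
  shows "ptime (\<lambda>a. tree_of_list (map (G a) (X a)))"
  using ptime_concat[OF X, of "\<lambda>a x. [G a x]"] ptime_list_single[OF G]
  by (simp only: concat_map_singleton)

lemma concat_map_if: "concat (map (\<lambda>x. if P x then [x] else []) xs) = filter P xs"
  by (induction xs) auto

lemma ptime_filter:
  assumes X: "ptime (\<lambda>a. tree_of_list (X a))"
    and P: "pdecidable (\<lambda>z. P (hd_tree z) (tl_tree (tl_tree z)))"
  shows "ptime (\<lambda>a. tree_of_list (filter (P a) (X a)))"
proof -
  have "ptime (\<lambda>z. tree_of_list (if P (hd_tree z) (tl_tree (tl_tree z)) then [tl_tree
      (tl_tree z)] else []))"
    by (intro ptime_list_If P ptime_list_single ptime_tl ptime_id ptime_list_const)
  from ptime_concat[OF X, of "\<lambda>a x. if P a x then [x] else []", OF this] show ?thesis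
    by (simp only: concat_map_if)
qed

text \<open>A bounded search is a comprehension that emits one \<open>Nl\<close> per hit; there is a
  hit iff the resulting list is not empty.\<close>

lemma pdecidable_ex_index:
  assumes X: "ptime (\<lambda>a. tree_of_list (X a))"
    and P: "pdecidable (\<lambda>z. P (hd_tree z) (hd_tree (tl_tree z)) (tl_tree (tl_tree z)))"
  shows "pdecidable (\<lambda>a. \<exists>i<length (X a). P a (enc_nat i) (X a ! i))"
proof -
  have "ptime (\<lambda>z. tree_of_list (if P (hd_tree z) (hd_tree (tl_tree z)) (tl_tree (tl_tree z))
      then [Nl] else []))"
    by (intro ptime_list_If P ptime_list_const)
  from ptime_concat_index[OF X, of "\<lambda>a i x. if P a i x then [Nl] else []", OF this]
  have "ptime (\<lambda>a. tree_of_list (concat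
      (map (\<lambda>i. if P a (enc_nat i) (X a ! i) then [Nl] else []) [0..<length (X a)])))" .
  then have "pdecidable (\<lambda>a. tree_of_list (concat
      (map (\<lambda>i. if P a (enc_nat i) (X a ! i) then [Nl] else []) [0..<length (X a)])) \<noteq> Nl)"
    by (intro pdecidable_not pdecidable_eq ptime_Nl)
  moreover have "tree_of_list (concat (map (\<lambda>i.
      if P a (enc_nat i) (X a ! i) then [Nl] else []) [0..<length (X a)])) \<noteq> Nl
    \<longleftrightarrow> (\<exists>i<length (X a). P a (enc_nat i) (X a ! i))" for a
  proof -
    have "concat (map (\<lambda>i. if Q i then [Nl] else []) ns) =
        map (\<lambda>i. Nl) (filter Q ns)" for Q and ns :: "nat list"
      by (induction ns) auto
    moreover have "tree_of_list xs \<noteq> Nl \<longleftrightarrow> xs \<noteq> []" for xs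
      by (cases xs) auto
    ultimately show ?thesis
      by (auto simp: filter_empty_conv)
  qed
  ultimately show ?thesis
    by simp
qed

lemma pdecidable_bex:
  assumes X: "ptime (\<lambda>a. tree_of_list (X a))"
    and P: "pdecidable (\<lambda>z. P (hd_tree z) (tl_tree (tl_tree z)))"
  shows "pdecidable (\<lambda>a. \<exists>x\<in>set (X a). P a x)"
proof -
  have "(\<exists>x\<in>set (X a). P a x) \<longleftrightarrow> (\<exists>i<length (X a). P a (X a !
      i))" for a
    by (metis in_set_conv_nth)
  then show ?thesis
    using pdecidable_ex_index[OF X, of "\<lambda>a i x. P a x", OF P] by simp
qed

lemmas ptime_intros = ptime_id ptime_hd ptime_tl ptime_Pr ptime_const ptime_If
  ptime_list_If ptime_list_single ptime_list_of_tree
  pdecidable_eq pdecidable_not pdecidable_conj pdecidable_disj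


section \<open>Matching cuts of graphs grouped into monochromatic cliques\<close>

definition groups_adjacent :: "'a set set \<Rightarrow> ('a \<Rightarrow> 'i) \<Rightarrow> 'i
    \<Rightarrow> 'i \<Rightarrow> bool" where
  "groups_adjacent E g S T \<longleftrightarrow> S \<noteq> T \<and>
      (\<exists>u v. {u, v} \<in> E \<and> g u = S \<and> g v = T)"

text \<open>The case \<open>T = U\<close> is included: a vertex with two neighbours in a group cannot
    be separated
  from it.\<close>

definition groups_conflict :: "'a set set \<Rightarrow> ('a \<Rightarrow> 'i) \<Rightarrow> 'i
    \<Rightarrow> 'i \<Rightarrow> 'i \<Rightarrow> bool" where
  "groups_conflict E g S T U \<longleftrightarrow> S \<noteq> T \<and> S \<noteq> U \<and>
     (\<exists>v w w'. w \<noteq> w' \<and> {v, w} \<in> E \<and> {v, w'} \<in> E \<and>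
         g v = S \<and> g w = T \<and> g w' = U)"

text \<open>Singletons are allowed, but groups of exactly two vertices are not: an edge inside a
  group always lies in a triangle of that group, which no matching cut can separate.\<close>

definition clique_grouping :: "'a set \<Rightarrow> 'a set set \<Rightarrow> ('a \<Rightarrow> 'i)
    \<Rightarrow> bool" where
  "clique_grouping V E g \<longleftrightarrow> simple_graph V E \<and>
     (\<forall>u\<in>V. \<forall>v\<in>V. u \<noteq> v \<longrightarrow> g u = g v \<longrightarrow>
        {u, v} \<in> E \<and> (\<exists>w\<in>V. w \<noteq> u \<and> w \<noteq> v \<and> g w = g u))"

text \<open>The set \<open>A\<close> is one colour class of the groups. No graph occurs here, so
  equal index sets, adjacencies and conflicts give literally the same set of candidates for the
  instance and for its kernel.\<close>

definition separated_pairs :: "'i set \<Rightarrow> ('i \<Rightarrow> 'i \<Rightarrow> bool)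
    \<Rightarrow> ('i \<Rightarrow> 'i \<Rightarrow> 'i \<Rightarrow> bool) \<Rightarrow> 'i set set
    set" where
  "separated_pairs I adj conf =
     {{{S, T} | S T. adj S T \<and> S \<in> A \<and> T \<notin> A} | A. A \<subseteq> I \<and>
         A \<noteq> {} \<and> A \<noteq> I \<and>
        (\<forall>S T U. conf S T U \<longrightarrow> \<not> ((S \<in> A) \<noteq> (T \<in> A) \<and>
            (S \<in> A) \<noteq> (U \<in> A)))}"

lemma simple_graph_edge:
  assumes "simple_graph V E" "{u, v} \<in> E"
  shows "u \<in> V" "v \<in> V" "u \<noteq> v"
  using assms unfolding simple_graph_def by (fastforce simp: card_insert_if split: if_splits)+

lemma simple_graph_edgeE:
  assumes "simple_graph V E" "e \<in> E"
  obtains u v where "e = {u, v}" "u \<noteq> v" "u \<in> V" "v \<in> V"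
proof -
  have "card e = 2" "e \<subseteq> V"
    using assms by (auto simp: simple_graph_def)
  then show thesis
    using that by (auto simp: card_2_iff)
qed

text \<open>Rephrases the matching condition as a statement about one vertex and two of its
  neighbours, the shape of a conflict.\<close>

lemma disjoint_edges_iff:
  assumes "\<And>e. e \<in> M \<Longrightarrow> \<exists>u v. e = {u, v} \<and> u \<noteq> v"
  shows "disjoint M \<longleftrightarrow> (\<forall>v w w'. {v, w} \<in> M \<longrightarrow> {v, w'}
      \<in> M \<longrightarrow> w = w')"
proof
  assume M: "disjoint M"
  show "\<forall>v w w'. {v, w} \<in> M \<longrightarrow> {v, w'} \<in> M \<longrightarrow> w = w'"
  proof (intro allI impI)
    fix v w w' assume "{v, w} \<in> M" "{v, w'} \<in> M"
    with disjointD[OF M this] show "w = w'"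
      by (auto simp: doubleton_eq_iff)
  qed
next
  assume M: "\<forall>v w w'. {v, w} \<in> M \<longrightarrow> {v, w'} \<in> M \<longrightarrow> w = w'"
  show "disjoint M"
  proof (rule disjointI)
    fix e f assume ef: "e \<in> M" "f \<in> M" "e \<noteq> f"
    show "e \<inter> f = {}"
    proof (rule ccontr)
      assume "e \<inter> f \<noteq> {}"
      then obtain x where "x \<in> e" "x \<in> f" by auto
      moreover have "\<exists>w. e = {x, w}" if "x \<in> e" "e \<in> M" for e x
        using assms[OF that(2)] that(1) by auto
      ultimately show False using M ef by metis
    qed
  qed
qed

text \<open>If \<open>u\<close> and \<open>v\<close> were separated, a third vertex \<open>w\<close>
  of the group would complete a triangle. On either side, \<open>w\<close> adds a cut edge that
  meets the cut edge between \<open>u\<close> and \<open>v\<close>.\<close>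

lemma matching_cut_monochromatic:
  assumes g: "clique_grouping V E g" and AB: "partition_on V {A, B}"
    and M: "disjoint (edges_between E A B)" and uv: "u \<in> V" "v \<in> V" "g u = g v" "u \<in> A"
  shows "v \<in> A"
proof (rule ccontr)
  assume "v \<notin> A"
  have V: "V = A \<union> B"
    using AB by (auto simp: partition_on_def)
  then have "v \<in> B" using \<open>v \<notin> A\<close> uv by auto
  have "u \<noteq> v" using uv \<open>v \<notin> A\<close> by auto
  then obtain w where w: "w \<in> V" "w \<noteq> u" "w \<noteq> v" "g w = g u"
    using g uv unfolding clique_grouping_def by metis
  have e: "{u, v} \<in> E" "{w, u} \<in> E" "{w, v} \<in> E"
    using g uv w \<open>u \<noteq> v\<close> unfolding clique_grouping_def by metis+
  have uvM: "{u, v} \<in> edges_between E A B"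
    using e uv \<open>v \<in> B\<close> unfolding edges_between_def by blast
  have "{w, v} \<in> edges_between E A B \<or> {w, u} \<in> edges_between E A B"
  proof (cases "w \<in> A")
    case True
    then show ?thesis using e \<open>v \<in> B\<close> unfolding edges_between_def by blast
  next
    case False
    then have "w \<in> B" using w V by auto
    then have "{w, u} \<in> edges_between E A B"
      using e uv unfolding edges_between_def by (auto simp: insert_commute)
    then show ?thesis ..
  qed
  then show False
    using disjointD[OF M uvM] w \<open>u \<noteq> v\<close> by (auto simp: doubleton_eq_iff)
qed

text \<open>Since groups are monochromatic, a cut is the preimage of a set of pairs of groups. These
  pairs can be read off from the cut again, because a separated pair is adjacent and therefore
  contributes at least one edge.\<close>

lemma matching_cuts_grouped:
  assumes g: "clique_grouping V E g"
  shows "matching_cuts V E = {{e \<in> E. g ` e \<in> Z} | Z. Z \<in> separated_pairs (g ` V)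
      (groups_adjacent E g) (groups_conflict E g)}"
    (is ?eq)
    and "Z \<in> separated_pairs (g ` V) (groups_adjacent E g) (groups_conflict E g)
        \<Longrightarrow> (`) g ` {e \<in> E. g ` e \<in> Z} = Z"
proof -
  let ?adj = "groups_adjacent E g" and ?conf = "groups_conflict E g"
  have simple: "simple_graph V E"
    using g by (simp add: clique_grouping_def)
  note edge = simple_graph_edge[OF simple]
  define Z where "Z = (\<lambda>A. {{S, T} | S T. ?adj S T \<and> S \<in> A \<and> T \<notin> A})"
  define ok where "ok = (\<lambda>A. A \<subseteq> g ` V \<and> A \<noteq> {} \<and> A \<noteq> g ` V \<and>
      (\<forall>S T U. ?conf S T U \<longrightarrow> \<not> ((S \<in> A) \<noteq> (T \<in> A) \<and>
          (S \<in> A) \<noteq> (U \<in> A))))"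
  have separated: "separated_pairs (g ` V) ?adj ?conf = {Z A | A. ok A}"
    unfolding separated_pairs_def Z_def ok_def by (rule refl)
  have cut: "{e \<in> E. g ` e \<in> Z A} = edges_between E {v\<in>V. g v \<in> A} {v\<in>V. g v
      \<notin> A}" for A
  proof (intro set_eqI)
    fix e
    show "e \<in> {e \<in> E. g ` e \<in> Z A} \<longleftrightarrow>
        e \<in> edges_between E {v\<in>V. g v \<in> A} {v\<in>V. g v \<notin> A}"
    proof
      assume e: "e \<in> {e \<in> E. g ` e \<in> Z A}"
      then obtain S T where ST: "g ` e = {S, T}" "S \<in> A" "T \<notin> A"
        by (auto simp: Z_def)
      obtain u v where uv: "e = {u, v}" "u \<in> V" "v \<in> V"
        using simple_graph_edgeE[OF simple] e by (metis (no_types, lifting) mem_Collect_eq)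
      then have "g u = S \<and> g v = T \<or> g v = S \<and> g u = T"
        using ST(1) by (auto simp: doubleton_eq_iff)
      then show "e \<in> edges_between E {v\<in>V. g v \<in> A} {v\<in>V. g v \<notin> A}"
        using uv ST e unfolding edges_between_def by (auto simp: insert_commute)
    next
      assume e: "e \<in> edges_between E {v\<in>V. g v \<in> A} {v\<in>V. g v \<notin> A}"
      then obtain a b where ab: "e = {a, b}" "e \<in> E" "g a \<in> A" "g b \<notin> A"
        by (auto simp: edges_between_def)
      then have "?adj (g a) (g b)"
        unfolding groups_adjacent_def by auto
      then have "{g a, g b} \<in> Z A"
        unfolding Z_def using ab by blast
      then show "e \<in> {e \<in> E. g ` e \<in> Z A}"
        using ab by simp
    qed
  qed
  \<comment> \<open>An edge is cut iff the groups of its ends lie on different sides of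
    \<open>A\<close>, so two cut edges at one vertex are exactly a violated conflict.\<close>
  have matching: "disjoint {e \<in> E. g ` e \<in> Z A} \<longleftrightarrow>
      (\<forall>S T U. ?conf S T U \<longrightarrow> \<not> ((S \<in> A) \<noteq> (T \<in> A) \<and>
          (S \<in> A) \<noteq> (U \<in> A)))" for A
  proof -
    have in_cut: "{v, w} \<in> {e \<in> E. g ` e \<in> Z A} \<longleftrightarrow>
        {v, w} \<in> E \<and> (g v \<in> A) \<noteq> (g w \<in> A)" for v w
      unfolding cut edges_between_def using edge[of v w] by (auto simp: doubleton_eq_iff)
    have "disjoint {e \<in> E. g ` e \<in> Z A} \<longleftrightarrow>
       (\<forall>v w w'. {v, w} \<in> {e \<in> E. g ` e \<in> Z A} \<longrightarrow> {v, w'} \<in> {e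
           \<in> E. g ` e \<in> Z A} \<longrightarrow> w = w')"
      by (rule disjoint_edges_iff) (use simple_graph_edgeE[OF simple] in blast)
    also have "\<dots> \<longleftrightarrow> (\<forall>S T U. ?conf S T U \<longrightarrow> \<not>
        ((S \<in> A) \<noteq> (T \<in> A) \<and> (S \<in> A) \<noteq> (U \<in> A)))"
      unfolding in_cut
    proof (intro iffI allI impI notI)
      fix S T U
      assume "\<forall>v w w'. {v, w} \<in> E \<and> (g v \<in> A) \<noteq> (g w \<in> A) \<longrightarrow>
          {v, w'} \<in> E \<and> (g v \<in> A) \<noteq> (g w' \<in> A) \<longrightarrow> w = w'"
        and "?conf S T U" "(S \<in> A) \<noteq> (T \<in> A) \<and> (S \<in> A) \<noteq> (U \<in> A)"
      then show False
        unfolding groups_conflict_def by blast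
    next
      fix v w w'
      assume conf: "\<forall>S T U. ?conf S T U \<longrightarrow> \<not> ((S \<in> A) \<noteq> (T
          \<in> A) \<and> (S \<in> A) \<noteq> (U \<in> A))"
        and vw: "{v, w} \<in> E \<and> (g v \<in> A) \<noteq> (g w \<in> A)" "{v, w'} \<in> E \<and>
            (g v \<in> A) \<noteq> (g w' \<in> A)"
      show "w = w'"
      proof (rule ccontr)
        assume "w \<noteq> w'"
        then have "?conf (g v) (g w) (g w')"
          using vw unfolding groups_conflict_def by (intro conjI exI) auto
        then show False
          using conf vw by blast
      qed
    qed
    finally show ?thesis .
  qed
  have part: "A \<noteq> {} \<and> A \<noteq> g ` V \<longleftrightarrow>
       {v\<in>V. g v \<in> A} \<noteq> {v\<in>V. g v \<notin> A} \<and>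
           partition_on V {{v\<in>V. g v \<in> A}, {v\<in>V. g v \<notin> A}}"
    if "A \<subseteq> g ` V" for A
  proof -
    have "A \<noteq> {} \<longleftrightarrow> {v\<in>V. g v \<in> A} \<noteq> {}"
        "A \<noteq> g ` V \<longleftrightarrow> {v\<in>V. g v \<notin> A} \<noteq> {}"
      using that by auto
    then show ?thesis
      by (auto simp: partition_on_def disjoint_def)
  qed
  show ?eq
  proof (intro set_eqI iffI)
    fix M assume "M \<in> matching_cuts V E"
    then obtain A B where AB: "disjoint M" "A \<noteq> B" "partition_on V {A, B}" "M = edges_between E A B"
      by (auto simp: matching_cuts_def)
    have V: "V = A \<union> B" "A \<inter> B = {}"
      using AB by (auto simp: partition_on_def disjoint_def)
    \<comment> \<open>Monochromaticity makes \<open>A\<close> a union of whole groups, so the image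
      of \<open>A\<close> under \<open>g\<close> is a colour class whose preimage is
      \<open>A\<close> itself.\<close>
    have mono: "v \<in> A" if "u \<in> V" "v \<in> V" "g u = g v" "u \<in> A" for u v
      using matching_cut_monochromatic[OF g AB(3)] AB(1,4) that by metis
    have "v \<in> A" if "v \<in> V" "g v \<in> g ` A" for v
      using mono V that by (metis Un_iff imageE)
    then have A: "A = {v\<in>V. g v \<in> g ` A}"
      using V by auto
    then have B: "B = {v\<in>V. g v \<notin> g ` A}"
      using V by auto
    have M: "M = {e \<in> E. g ` e \<in> Z (g ` A)}"
      unfolding cut using AB(4) A B by simp
    have "g ` A \<subseteq> g ` V" using V by auto
    moreover from this have "g ` A \<noteq> {}" "g ` A \<noteq> g ` V"
      using part[of "g ` A"] AB(2,3) A B by auto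
    moreover have "\<forall>S T U. ?conf S T U \<longrightarrow> \<not> ((S \<in> g ` A) \<noteq> (T
        \<in> g ` A) \<and> (S \<in> g ` A) \<noteq> (U \<in> g ` A))"
      using matching AB(1) M by blast
    ultimately have "ok (g ` A)"
      unfolding ok_def by (intro conjI)
    then have "Z (g ` A) \<in> separated_pairs (g ` V) ?adj ?conf"
      unfolding separated by (intro CollectI exI conjI) (rule refl)
    then show "M \<in> {{e \<in> E. g ` e \<in> Z} | Z. Z \<in> separated_pairs (g ` V) ?adj ?conf}"
      using M by (intro CollectI exI conjI)
  next
    fix M assume "M \<in> {{e \<in> E. g ` e \<in> Z} | Z. Z \<in> separated_pairs (g ` V) ?adj ?conf}"
    then obtain A where "ok A" "M = {e \<in> E. g ` e \<in> Z A}"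
      unfolding separated by blast
    then have A: "A \<subseteq> g ` V" "A \<noteq> {}" "A \<noteq> g ` V"
        "\<forall>S T U. ?conf S T U \<longrightarrow> \<not> ((S \<in> A) \<noteq> (T \<in> A)
            \<and> (S \<in> A) \<noteq> (U \<in> A))"
        "M = {e \<in> E. g ` e \<in> Z A}"
      unfolding ok_def by blast+
    then show "M \<in> matching_cuts V E"
      unfolding matching_cuts_def using matching[of A] part[of A] cut[of A]
      by (intro CollectI conjI exI[of _ "{v\<in>V. g v \<in> A}"] exI[of _ "{v\<in>V. g v \<notin>
          A}"]) simp_all
  qed
  show "(`) g ` {e \<in> E. g ` e \<in> Y} = Y" if Y: "Y \<in> separated_pairs (g ` V) ?adj ?conf" for Y
  proof -
    have "\<exists>e\<in>E. g ` e = y" if y: "y \<in> Y" for y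
    proof -
      obtain A where "Y = Z A"
        using Y unfolding separated by blast
      then obtain S T where ST: "y = {S, T}" "?adj S T"
        using y unfolding Z_def by blast
      then obtain u v where "{u, v} \<in> E" "g u = S" "g v = T"
        unfolding groups_adjacent_def by auto
      then show ?thesis using ST by (intro bexI[of _ "{u, v}"]) auto
    qed
    then have "y \<in> (`) g ` {e \<in> E. g ` e \<in> Y}" if "y \<in> Y" for y
      using that by (metis (mono_tags, lifting) image_eqI mem_Collect_eq)
    then show ?thesis by auto
  qed
qed

text \<open>The translation goes through pairs of groups without choosing a colouring, so the
  lifting algorithm can decide it edge by edge.\<close>

definition transfer_cut :: "'a set set \<Rightarrow> ('a \<Rightarrow> 'i) \<Rightarrow> ('b
    \<Rightarrow> 'i) \<Rightarrow> 'b set set \<Rightarrow> 'a set set" where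
  "transfer_cut E g h M = {e \<in> E. g ` e \<in> (`) h ` M}"

text \<open>Both families of cuts are images of one set \<open>Q\<close> of sets of pairs, under
  maps \<open>a\<close> and \<open>b\<close> that have left inverses on \<open>Q\<close>; the
  transfer sends \<open>b Z\<close> to \<open>a Z\<close>.\<close>

lemma transfer_cut_bij:
  assumes g: "clique_grouping V E g" and h: "clique_grouping W F h" and I: "g ` V = h ` W"
    and adj: "groups_adjacent E g = groups_adjacent F h"
    and conf: "groups_conflict E g = groups_conflict F h"
  shows "bij_betw (transfer_cut E g h) (matching_cuts W F) (matching_cuts V E)"
    and "\<lbrakk>M \<in> matching_cuts W F; N \<in> matching_cuts W F\<rbrakk> \<Longrightarrow>
       transfer_cut E g h M \<subseteq> transfer_cut E g h N \<longleftrightarrow> M \<subseteq> N"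
proof -
  define Q where "Q = separated_pairs (g ` V) (groups_adjacent E g) (groups_conflict E g)"
  have Q: "Q = separated_pairs (h ` W) (groups_adjacent F h) (groups_conflict F h)"
    by (simp add: Q_def I adj conf)
  define a where "a = (\<lambda>Z. {e \<in> E. g ` e \<in> Z})"
  define b where "b = (\<lambda>Z. {e \<in> F. h ` e \<in> Z})"
  have mcE: "matching_cuts V E = a ` Q"
    unfolding matching_cuts_grouped(1)[OF g] Q_def a_def by (rule Setcompr_eq_image)
  have mcF: "matching_cuts W F = b ` Q"
    unfolding matching_cuts_grouped(1)[OF h] Q b_def by (rule Setcompr_eq_image)
  have a: "(`) g ` a Z = Z" if "Z \<in> Q" for Z
    unfolding a_def by (rule matching_cuts_grouped(2)[OF g that[unfolded Q_def]])
  have b: "(`) h ` b Z = Z" if "Z \<in> Q" for Z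
    unfolding b_def by (rule matching_cuts_grouped(2)[OF h that[unfolded Q]])
  have tr: "transfer_cut E g h (b Z) = a Z" if "Z \<in> Q" for Z
    using b[OF that] by (simp add: transfer_cut_def a_def)
  show "bij_betw (transfer_cut E g h) (matching_cuts W F) (matching_cuts V E)"
    unfolding mcE mcF
  proof (rule bij_betw_imageI)
    show "inj_on (transfer_cut E g h) (b ` Q)"
      using a tr by (intro inj_onI) (metis (no_types, lifting) imageE)
    show "transfer_cut E g h ` b ` Q = a ` Q"
      unfolding image_image using tr by (rule image_cong[OF refl])
  qed
  \<comment> \<open>Taking preimages is monotone, and so is its left inverse, the direct image;
    hence inclusion is reflected as well as preserved.\<close>
  have "Z \<subseteq> Z' \<longleftrightarrow> a Z \<subseteq> a Z'" if "Z \<in> Q" "Z' \<in> Q" for Z Z'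
    using image_mono[of "a Z" "a Z'" "(`) g"] a[OF that(1)] a[OF that(2)] by (auto simp: a_def)
  moreover have "Z \<subseteq> Z' \<longleftrightarrow> b Z \<subseteq> b Z'"
      if "Z \<in> Q" "Z' \<in> Q" for Z Z'
    using image_mono[of "b Z" "b Z'" "(`) h"] b[OF that(1)] b[OF that(2)] by (auto simp: b_def)
  ultimately show "transfer_cut E g h M \<subseteq> transfer_cut E g h N \<longleftrightarrow>
      M \<subseteq> N"
    if "M \<in> matching_cuts W F" "N \<in> matching_cuts W F"
    using that tr unfolding mcF by (metis (no_types, lifting) imageE)
qed

text \<open>Stated for arbitrary relations so that it serves for inclusion and for reverse inclusion
  alike.\<close>

lemma bij_betw_minimal:
  assumes f: "bij_betw f X Y" and mono: "\<And>M N. M \<in> X \<Longrightarrow>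
      N \<in> X \<Longrightarrow> R' (f M) (f N) \<longleftrightarrow> R M N"
  shows "bij_betw f {M \<in> X. \<forall>N\<in>X. R N M \<longrightarrow> N =
      M} {M \<in> Y. \<forall>N\<in>Y. R' N M \<longrightarrow> N = M}"
proof -
  have Y: "Y = f ` X" and inj: "inj_on f X"
    using f by (auto simp: bij_betw_def)
  have "f ` {M \<in> X. \<forall>N\<in>X. R N M \<longrightarrow> N = M} =
      {M \<in> Y. \<forall>N\<in>Y. R' N M \<longrightarrow> N = M}"
    unfolding Y using mono inj by (auto simp: inj_on_eq_iff)
  then show ?thesis
    using inj by (auto simp: bij_betw_def intro: inj_on_subset)
qed

lemma transfer_cut_bij_extremal:
  assumes "clique_grouping V E g" "clique_grouping W F h" "g ` V = h ` W"
    "groups_adjacent E g = groups_adjacent F h" "groups_conflict E g = groups_conflict F h"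
  shows "bij_betw (transfer_cut E g h) (minimal_matching_cuts W F) (minimal_matching_cuts V E)"
    "bij_betw (transfer_cut E g h) (maximal_matching_cuts W F) (maximal_matching_cuts V E)"
proof -
  let ?f = "transfer_cut E g h"
  show "bij_betw ?f (minimal_matching_cuts W F) (minimal_matching_cuts V E)"
    unfolding minimal_matching_cuts_def
    by (rule bij_betw_minimal[OF transfer_cut_bij(1)[OF assms]]) (rule transfer_cut_bij(2)[OF assms])
  show "bij_betw ?f (maximal_matching_cuts W F) (maximal_matching_cuts V E)"
    unfolding maximal_matching_cuts_def
    by (rule bij_betw_minimal[OF transfer_cut_bij(1)[OF assms], where R =
        "\<lambda>N M. M \<subseteq> N" and R' = "\<lambda>N M. M \<subseteq> N"])
      (rule transfer_cut_bij(2)[OF assms])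
qed


section \<open>The kernel\<close>

definition tree_edges :: "tree \<Rightarrow> tree list" where
  "tree_edges a = list_of_tree (hd_tree (tl_tree a))"

text \<open>The test on \<open>K\<close> holds exactly for lists with at least three entries.
  Smaller cliques are split into encoded singletons.\<close>

definition tree_groups :: "tree \<Rightarrow> tree list" where
  "tree_groups a = concat (map (\<lambda>K. if tl_tree (tl_tree K) \<noteq> Nl then [K]
     else map (\<lambda>v. Pr v Nl) (list_of_tree K)) (list_of_tree (hd_tree (tl_tree (tl_tree a)))))"

text \<open>Edges are stored with the smaller endpoint first, so both orders have to be
  tried.\<close>

definition tree_adjacent :: "tree \<Rightarrow> tree \<Rightarrow> tree \<Rightarrow> bool" where
  "tree_adjacent a u v \<longleftrightarrow> (\<exists>e\<in>set (tree_edges a). e =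
      Pr u (Pr v Nl) \<or> e = Pr v (Pr u Nl))"

definition tree_groups_adjacent :: "tree \<Rightarrow> tree \<Rightarrow> tree \<Rightarrow> bool" where
  "tree_groups_adjacent a S T \<longleftrightarrow> S \<noteq> T \<and>
     (\<exists>u\<in>set (list_of_tree S). \<exists>v\<in>set (list_of_tree T). tree_adjacent a u v)"

definition tree_groups_conflict :: "tree \<Rightarrow> tree \<Rightarrow> tree \<Rightarrow> tree
    \<Rightarrow> bool" where
  "tree_groups_conflict a S T U \<longleftrightarrow> S \<noteq> T \<and> S \<noteq> U \<and>
     (\<exists>v\<in>set (list_of_tree S). \<exists>w\<in>set (list_of_tree T). \<exists>w'\<in>set
         (list_of_tree U).
        w \<noteq> w' \<and> tree_adjacent a v w \<and> tree_adjacent a v w')"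

text \<open>The first component is the group in whose clique the vertex lies; \<open>T\<close> and
  \<open>U\<close> name the other groups of the gadget, and \<open>r\<close> is the role.\<close>

abbreviation label :: "tree \<Rightarrow> tree \<Rightarrow> tree \<Rightarrow> tree \<Rightarrow> tree" where
  "label S T U r \<equiv> Pr S (Pr T (Pr U r))"

text \<open>All triples occur, also those without a conflict. The vertices that carry no gadget pad
  the cliques, so that each has the three vertices that make it monochromatic.\<close>

definition labels :: "tree \<Rightarrow> tree list" where
  "labels a = concat (map (\<lambda>S. concat (map (\<lambda>T. concat (map (\<lambda>U.
     map (label S T U) [enc_nat 0, enc_nat 1, enc_nat 2, enc_nat 3])
     (tree_groups a))) (tree_groups a))) (tree_groups a))"

text \<open>The vertex \<open>label S T U (enc_nat 0)\<close> of the clique of the group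
    \<open>S\<close> realises a conflict of
  \<open>S\<close> with \<open>T\<close> and \<open>U\<close>,
      and \<open>label S T T (enc_nat 3)\<close> realises an adjacency of \<open>S\<close>
      and \<open>T\<close>.
  All other vertices have at most one neighbour outside of their clique.\<close>

definition label_arc :: "tree \<Rightarrow> tree \<Rightarrow> tree \<Rightarrow> bool" where
  "label_arc a l l' \<longleftrightarrow> (let S = hd_tree l; T = hd_tree (tl_tree l);
       U = hd_tree (tl_tree (tl_tree l)); r = tl_tree (tl_tree (tl_tree l))
     in r = enc_nat 0 \<and> tree_groups_conflict a S T U \<and>
          (l' = label T S U (enc_nat 1) \<or> l' = label U S T (enc_nat 2)) \<or>
        r = enc_nat 3 \<and> tree_groups_adjacent a S T \<and> T = U \<and> l' = label T S S (enc_nat 3))"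

definition labels_adjacent :: "tree \<Rightarrow> tree \<Rightarrow> tree \<Rightarrow> bool" where
  "labels_adjacent a l l' \<longleftrightarrow>
     l \<noteq> l' \<and> (hd_tree l = hd_tree l' \<or> label_arc a l l' \<or> label_arc a l' l)"

text \<open>Compares unary numbers by a bounded search, to stay within the available
  combinators.\<close>

definition tree_less :: "tree \<Rightarrow> tree \<Rightarrow> bool" where
  "tree_less m n \<longleftrightarrow> (\<exists>i<length (list_of_tree n). enc_nat i = m)"

lemma tree_less_enc_nat [simp]: "tree_less (enc_nat m) (enc_nat n) \<longleftrightarrow> m < n"
  using enc_nat_inj by (auto simp: tree_less_def)

text \<open>Scanning \<open>i\<close> and then \<open>j\<close> upwards emits the pairs in
  lexicographic order, so the canonical encoding is produced without a sorting step.\<close>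

definition kernel_edges :: "tree \<Rightarrow> tree list" where
  "kernel_edges a = concat (map (\<lambda>i. concat (map (\<lambda>j.
     if tree_less (enc_nat i) (enc_nat j) \<and> labels_adjacent a (labels a ! i) (labels a ! j)
     then [Pr (enc_nat i) (Pr (enc_nat j) Nl)] else [])
     [0..<length (labels a)])) [0..<length (labels a)])"

text \<open>Only the smallest index of a clique emits it. The blocks thus appear once each, ordered
  by their first entries, as the canonical encoding demands.\<close>

definition kernel_cliques :: "tree \<Rightarrow> tree list" where
  "kernel_cliques a = concat (map (\<lambda>i.
     if \<exists>j<length (labels a). tree_less (enc_nat j) (enc_nat i) \<and>
         hd_tree (labels a ! j) = hd_tree (labels a ! i)
     then []
     else [tree_of_list (concat (map (\<lambda>j.
         if hd_tree (labels a ! j) = hd_tree (labels a ! i) then [enc_nat j] else [])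
             [0..<length (labels a)]))])
     [0..<length (labels a)])"

text \<open>The last component doubles the parameter, by appending a unary number to itself.\<close>

definition kernel_tree :: "tree \<Rightarrow> tree" where
  "kernel_tree a = Pr (enc_nat (length (labels a))) (Pr (tree_of_list (kernel_edges a))
     (Pr (tree_of_list (kernel_cliques a))
       (tree_of_list (list_of_tree (tl_tree (tl_tree (tl_tree a))) @ list_of_tree (tl_tree (tl_tree
           (tl_tree a)))))))"

text \<open>The order of the ends of \<open>e\<close> need not agree with the order of
  \<open>i\<close> and \<open>j\<close>, hence the two alternatives. Filtering keeps the order of
  the input edges, so the result is again canonical.\<close>

definition lift_edges :: "tree \<Rightarrow> tree \<Rightarrow> tree list" where
  "lift_edges a M = filter (\<lambda>e. \<exists>f\<in>set (list_of_tree M).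
     \<exists>i<length (labels a). \<exists>j<length (labels a). f = Pr (enc_nat i) (Pr (enc_nat j) Nl) \<and>
       (hd_tree e \<in> set (list_of_tree (hd_tree (labels a ! i))) \<and>
          hd_tree (tl_tree e) \<in> set (list_of_tree (hd_tree (labels a ! j))) \<or>
        hd_tree e \<in> set (list_of_tree (hd_tree (labels a ! j))) \<and>
          hd_tree (tl_tree e) \<in> set (list_of_tree (hd_tree (labels a ! i)))))
     (tree_edges a)"

section \<open>Running times of the kernelization and of the lifting\<close>

lemma pdecidable_mem:
  assumes "ptime f" "ptime g"
  shows "pdecidable (\<lambda>a. f a \<in> set (list_of_tree (g a)))"
proof -
  have "pdecidable (\<lambda>a. \<exists>x\<in>set (list_of_tree (g a)). f a = x)"
    by (intro pdecidable_bex pdecidable_eq ptime_comp[OF assms(1)] ptime_intros assms)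
  then show ?thesis by simp
qed

lemma ptime_tree_edges: "ptime f \<Longrightarrow> ptime (\<lambda>a. tree_of_list (tree_edges (f a)))"
  unfolding tree_edges_def by (intro ptime_intros)

lemma ptime_tree_groups:
  assumes "ptime f"
  shows "ptime (\<lambda>a. tree_of_list (tree_groups (f a)))"
  unfolding tree_groups_def
  by (intro ptime_concat ptime_map ptime_intros assms)

lemma pdecidable_tree_adjacent:
  assumes "ptime f" "ptime g" "ptime h"
  shows "pdecidable (\<lambda>a. tree_adjacent (f a) (g a) (h a))"
  unfolding tree_adjacent_def
  by (intro pdecidable_bex ptime_tree_edges ptime_intros ptime_comp[OF assms(1)]
      ptime_comp[OF assms(2)] ptime_comp[OF assms(3)])

lemma pdecidable_tree_groups_adjacent:
  assumes "ptime f" "ptime g" "ptime h"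
  shows "pdecidable (\<lambda>a. tree_groups_adjacent (f a) (g a) (h a))"
  unfolding tree_groups_adjacent_def
  by (intro pdecidable_bex pdecidable_tree_adjacent ptime_intros ptime_comp[OF assms(1)]
      ptime_comp[OF assms(2)] ptime_comp[OF assms(3)])

lemma pdecidable_tree_groups_conflict:
  assumes "ptime f" "ptime g" "ptime h" "ptime k"
  shows "pdecidable (\<lambda>a. tree_groups_conflict (f a) (g a) (h a) (k a))"
  unfolding tree_groups_conflict_def
  by (intro pdecidable_bex pdecidable_tree_adjacent ptime_intros ptime_comp[OF assms(1)]
      ptime_comp[OF assms(2)] ptime_comp[OF assms(3)] ptime_comp[OF assms(4)])

lemma ptime_labels:
  assumes "ptime f"
  shows "ptime (\<lambda>a. tree_of_list (labels (f a)))"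
  unfolding labels_def
  by (intro ptime_concat ptime_map ptime_tree_groups ptime_list_const ptime_intros ptime_comp[OF assms])

lemma pdecidable_labels_adjacent:
  assumes "ptime f" "ptime g" "ptime h"
  shows "pdecidable (\<lambda>a. labels_adjacent (f a) (g a) (h a))"
  unfolding labels_adjacent_def label_arc_def Let_def
  by (intro pdecidable_tree_groups_adjacent pdecidable_tree_groups_conflict ptime_intros assms)

lemma pdecidable_tree_less:
  assumes "ptime f" "ptime g"
  shows "pdecidable (\<lambda>a. tree_less (f a) (g a))"
  unfolding tree_less_def
  by (intro pdecidable_ex_index[where P = "\<lambda>a i x. i =
      f a"] ptime_intros assms ptime_comp[OF assms(1)])

lemma ptime_kernel_edges: "ptime (\<lambda>a. tree_of_list (kernel_edges a))"
  unfolding kernel_edges_def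
  \<comment> \<open>The inner loop has the triple \<open>z\<close> of the outer one as its
    environment: \<open>hd_tree z\<close> is the instance, \<open>hd_tree (tl_tree z)\<close> the
    outer index and \<open>tl_tree (tl_tree z)\<close> the outer label, which stands for the lookup
    \<open>labels a ! i\<close>.\<close>
  by (intro ptime_concat_index[where X = labels and G = "\<lambda>a i x. concat (map (\<lambda>j.
       if tree_less i (enc_nat j) \<and> labels_adjacent a x (labels a ! j)
       then [Pr i (Pr (enc_nat j) Nl)] else []) [0..<length (labels a)])"]
      ptime_concat_index[where X = "\<lambda>z. labels (hd_tree z)" and G = "\<lambda>z j y.
       if tree_less (hd_tree (tl_tree z)) j \<and> labels_adjacent (hd_tree z) (tl_tree (tl_tree z)) y
       then [Pr (hd_tree (tl_tree z)) (Pr j Nl)] else []"]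
     ptime_labels pdecidable_tree_less pdecidable_labels_adjacent ptime_intros ptime_list_const)

lemma ptime_kernel_cliques: "ptime (\<lambda>a. tree_of_list (kernel_cliques a))"
  unfolding kernel_cliques_def
  by (intro ptime_concat_index[where X = labels and G = "\<lambda>a i x.
     if \<exists>j<length (labels a). tree_less (enc_nat j) i \<and> hd_tree (labels a ! j) = hd_tree x
     then []
     else [tree_of_list (concat (map (\<lambda>j.
         if hd_tree (labels a ! j) = hd_tree x then [enc_nat j] else [])
             [0..<length (labels a)]))]"]
      ptime_concat_index[where X = "\<lambda>z. labels (hd_tree z)" and G = "\<lambda>z j y.
         if hd_tree y = hd_tree (tl_tree (tl_tree z)) then [j] else []"]
      pdecidable_ex_index[where X = "\<lambda>z. labels (hd_tree z)" and
        P = "\<lambda>z j y. tree_less j (hd_tree (tl_tree z)) \<and>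
            hd_tree y = hd_tree (tl_tree (tl_tree z))"]
     ptime_labels pdecidable_tree_less ptime_intros ptime_list_const)

text \<open>In unary, a length is the list itself with every entry replaced by
  \<open>Nl\<close>.\<close>

lemma ptime_enc_length:
  assumes "ptime (\<lambda>a. tree_of_list (f a))"
  shows "ptime (\<lambda>a. enc_nat (length (f a)))"
proof -
  have "ptime (\<lambda>a. tree_of_list (map (\<lambda>_. Nl) (f a)))"
    by (intro ptime_map ptime_intros assms)
  then show ?thesis
    by (simp add: map_replicate_const tree_of_replicate)
qed

lemma ptime_kernel_tree: "ptime kernel_tree"
  unfolding kernel_tree_def[abs_def]
  by (intro ptime_enc_length ptime_append ptime_labels ptime_kernel_edges ptime_kernel_cliques ptime_intros)

lemma ptime_lift_edges:
  assumes "ptime f" "ptime g"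
  shows "ptime (\<lambda>a. tree_of_list (lift_edges (f a) (g a)))"
proof -
  \<comment> \<open>The selection condition, as a predicate on the single tree
    \<open>Pr a (Pr M e)\<close>.\<close>
  define P where "P = (\<lambda>a.
     \<exists>h\<in>set (list_of_tree (hd_tree (tl_tree a))).
     \<exists>i<length (labels (hd_tree a)). \<exists>j<length (labels (hd_tree a)). h =
         Pr (enc_nat i) (Pr (enc_nat j) Nl) \<and>
       (hd_tree (tl_tree (tl_tree a)) \<in> set (list_of_tree (hd_tree (labels (hd_tree a) ! i))) \<and>
          hd_tree (tl_tree (tl_tree (tl_tree a))) \<in> set (list_of_tree (hd_tree (labels (hd_tree
              a) ! j))) \<or>
        hd_tree (tl_tree (tl_tree a)) \<in> set (list_of_tree (hd_tree (labels (hd_tree a) ! j))) \<and>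
          hd_tree (tl_tree (tl_tree (tl_tree a))) \<in> set (list_of_tree (hd_tree (labels (hd_tree
              a) ! i)))))"
  have P: "pdecidable P"
    unfolding P_def
    apply (rule pdecidable_bex, intro ptime_intros)
    \<comment> \<open>Each nested search wraps its environment into a new triple, so references to
      outer data gain one \<open>hd_tree\<close> per level. The instantiations spell this out for
      the loops over \<open>i\<close> and \<open>j\<close>.\<close>
    apply (rule pdecidable_ex_index[where X = "\<lambda>z. labels (hd_tree (hd_tree z))"
        and P = "\<lambda>z i x.
      \<exists>j<length (labels (hd_tree (hd_tree z))). tl_tree (tl_tree z) = Pr i (Pr (enc_nat j) Nl) \<and>
       (hd_tree (tl_tree (tl_tree (hd_tree z))) \<in> set (list_of_tree (hd_tree x)) \<and>
          hd_tree (tl_tree (tl_tree (tl_tree (hd_tree z)))) \<in> set (list_of_tree (hd_tree (labels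
              (hd_tree (hd_tree z)) ! j))) \<or>
        hd_tree (tl_tree (tl_tree (hd_tree z))) \<in> set (list_of_tree (hd_tree (labels (hd_tree
            (hd_tree z)) ! j))) \<and>
          hd_tree (tl_tree (tl_tree (tl_tree (hd_tree z)))) \<in> set (list_of_tree (hd_tree x)))"])
     apply (intro ptime_labels ptime_intros)
    apply (rule pdecidable_ex_index[where X = "\<lambda>z. labels (hd_tree (hd_tree (hd_tree z)))"
        and P = "\<lambda>z j y.
       tl_tree (tl_tree (hd_tree z)) = Pr (hd_tree (tl_tree z)) (Pr j Nl) \<and>
       (hd_tree (tl_tree (tl_tree (hd_tree (hd_tree z)))) \<in> set (list_of_tree (hd_tree (tl_tree
           (tl_tree z)))) \<and>
          hd_tree (tl_tree (tl_tree (tl_tree (hd_tree (hd_tree z))))) \<in> set (list_of_tree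
              (hd_tree y)) \<or>
        hd_tree (tl_tree (tl_tree (hd_tree (hd_tree z)))) \<in> set (list_of_tree (hd_tree y)) \<and>
          hd_tree (tl_tree (tl_tree (tl_tree (hd_tree (hd_tree z))))) \<in> set (list_of_tree
              (hd_tree (tl_tree (tl_tree z)))))"])
     apply (intro ptime_labels ptime_intros)
    apply (intro pdecidable_mem ptime_intros)
    done
  have lift: "lift_edges a M = filter (\<lambda>e. P (Pr a (Pr M e))) (tree_edges a)" for a M
    unfolding lift_edges_def P_def by simp
  show ?thesis
    unfolding lift
    by (intro ptime_filter ptime_tree_edges assms ptime_comp[OF P] ptime_Pr
        ptime_comp[OF assms(1)] ptime_comp[OF assms(2)] ptime_intros)
qed


section \<open>Adjacencies and conflicts realised by the labels\<close>

lemma mem_labels: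
  "l \<in> set (labels a) \<longleftrightarrow> (\<exists>S T U r. l = label S T U r \<and>
      S \<in> set (tree_groups a) \<and>
     T \<in> set (tree_groups a) \<and> U \<in> set (tree_groups a) \<and>
         r \<in> {enc_nat 0, enc_nat 1, enc_nat 2, enc_nat 3})"
  unfolding labels_def by auto

lemma distinct_concat_map:
  assumes "distinct xs" "\<And>x. x \<in> set xs \<Longrightarrow> distinct (f x)"
    and "\<And>x y. x \<in> set xs \<Longrightarrow> y \<in> set xs \<Longrightarrow>
        x \<noteq> y \<Longrightarrow> set (f x) \<inter> set (f y) = {}"
  shows "distinct (concat (map f xs))"
  using assms
proof (induction xs)
  case (Cons x xs)
  then have "distinct (concat (map f xs))" by simp
  moreover have "set (f x) \<inter> set (concat (map f xs)) = {}"
    using Cons.prems by fastforce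
  ultimately show ?case
    using Cons.prems by simp
qed simp

lemma enc_nat_eq_iff [simp]: "enc_nat m = enc_nat n \<longleftrightarrow> m = n"
  using enc_nat_inj by blast

lemma distinct_labels:
  assumes "distinct (tree_groups a)"
  shows "distinct (labels a)"
  unfolding labels_def
proof (intro distinct_concat_map assms)
  show "distinct (map (label S T U) [enc_nat 0, enc_nat 1, enc_nat 2, enc_nat 3])" for S T U
    by (simp del: enc_nat.simps)
qed auto

lemma length_labels: "length (labels a) = 4 * length (tree_groups a) ^ 3"
  by (simp add: labels_def length_concat comp_def sum_list_triv power3_eq_cube del: enc_nat.simps)

lemma tree_adjacent_sym: "tree_adjacent a u v \<longleftrightarrow> tree_adjacent a v u"
  by (auto simp: tree_adjacent_def)

lemma tree_groups_adjacent_sym: "tree_groups_adjacent a S T \<longleftrightarrow> tree_groups_adjacent a T S"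
  using tree_adjacent_sym unfolding tree_groups_adjacent_def by metis

lemma tree_groups_conflict_sym: "tree_groups_conflict a S T U \<longleftrightarrow>
    tree_groups_conflict a S U T"
proof -
  have "tree_groups_conflict a S U T" if "tree_groups_conflict a S T U" for T U
    using that unfolding tree_groups_conflict_def by (elim conjE bexE) (intro conjI bexI, auto)
  then show ?thesis by blast
qed

text \<open>This is why conflict gadgets create no new adjacency: both of their edges join groups
  that are adjacent already.\<close>

lemma tree_groups_conflict_adjacent:
  "tree_groups_conflict a S T U \<Longrightarrow> tree_groups_adjacent a S T \<and>
      tree_groups_adjacent a S U"
  unfolding tree_groups_conflict_def tree_groups_adjacent_def by metis

lemma labels_adjacent_sym: "labels_adjacent a l l' \<longleftrightarrow> labels_adjacent a l' l"
  unfolding labels_adjacent_def by metis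

lemma label_arc_label:
  "label_arc a (label S T U r) l' \<longleftrightarrow>
     r = enc_nat 0 \<and> tree_groups_conflict a S T U \<and>
       (l' = label T S U (enc_nat 1) \<or> l' = label U S T (enc_nat 2)) \<or>
     r = enc_nat 3 \<and> tree_groups_adjacent a S T \<and> T = U \<and> l' = label T S S (enc_nat 3)"
  by (simp add: label_arc_def Let_def)

lemma labels_adjacent_groups_adjacent:
  assumes "l \<in> set (labels a)" "l' \<in> set (labels a)" "labels_adjacent a l l'"
      "hd_tree l \<noteq> hd_tree l'"
  shows "tree_groups_adjacent a (hd_tree l) (hd_tree l')"
proof -
  have arc: "tree_groups_adjacent a (hd_tree l) (hd_tree l')"
    if "l \<in> set (labels a)" "label_arc a l l'" for l l'
    using that tree_groups_conflict_adjacent unfolding mem_labels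
    by (auto simp: label_arc_label simp del: enc_nat.simps)
  show ?thesis
    using assms arc[of l l'] arc[of l' l] tree_groups_adjacent_sym unfolding labels_adjacent_def by metis
qed

text \<open>A label of role 1, 2 or 3 determines its only possible neighbour in another clique, so
  two distinct outer neighbours force role 0. They are then the two ends of one gadget, in either
  order; symmetry of conflicts covers the swap.\<close>

lemma labels_adjacent_conflict:
  assumes "l \<in> set (labels a)" "l' \<in> set (labels a)" "l'' \<in> set (labels a)"
    and "labels_adjacent a l l'" "labels_adjacent a l l''" "l' \<noteq> l''"
    and "hd_tree l \<noteq> hd_tree l'" "hd_tree l \<noteq> hd_tree l''"
  shows "tree_groups_conflict a (hd_tree l) (hd_tree l') (hd_tree l'')"
proof -
  obtain S T U r where l: "l = label S T U r"
    using assms(1) by (auto simp: mem_labels)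
  obtain S' T' U' r' where l': "l' = label S' T' U' r'"
    using assms(2) by (auto simp: mem_labels)
  obtain S'' T'' U'' r'' where l'': "l'' = label S'' T'' U'' r''"
    using assms(3) by (auto simp: mem_labels)
  have "label_arc a l l' \<or> label_arc a l' l" "label_arc a l l'' \<or> label_arc a l'' l"
    using assms by (auto simp: labels_adjacent_def)
  then show ?thesis
    using assms(6-8) unfolding l l' l'' label_arc_label
    by (auto simp del: enc_nat.simps intro: tree_groups_conflict_sym[THEN iffD1])
qed

section \<open>The kernel as a graph with a clique partition\<close>

text \<open>Vertices are positions in the list of labels, because instances live on initial segments
  of the naturals. The parameter doubles since splitting small cliques can double their
  number.\<close>

definition kernel :: "cp_graph \<Rightarrow> cp_graph" where
  "kernel x = (let a = enc_cp_graph x; L = labels a in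
     \<lparr>nverts = length L,
      edges = {{i, j} | i j. i < j \<and> j < length L \<and> labels_adjacent a (L ! i) (L ! j)},
      cliques = {{j. j < length L \<and> hd_tree (L ! j) = hd_tree (L ! i)} | i. i < length L},
      bound = 2 * bound x\<rparr>)"

definition kernel_group :: "cp_graph \<Rightarrow> nat \<Rightarrow> tree" where
  "kernel_group x i = hd_tree (labels (enc_cp_graph x) ! i)"

lemma kernel_simps:
  "nverts (kernel x) = length (labels (enc_cp_graph x))"
  "edges (kernel x) = {{i, j} | i j. i < j \<and> j < length (labels (enc_cp_graph x)) \<and>
     labels_adjacent (enc_cp_graph x) (labels (enc_cp_graph x) ! i) (labels (enc_cp_graph x) ! j)}"
  "cliques (kernel x) = (\<lambda>S. {j. j < nverts (kernel x) \<and>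
      kernel_group x j = S}) ` kernel_group x ` {..<nverts (kernel x)}"
  "bound (kernel x) = 2 * bound x"
  by (auto simp: kernel_def Let_def kernel_group_def)

lemma kernel_edge_iff:
  "{i, j} \<in> edges (kernel x) \<longleftrightarrow> i < nverts (kernel x) \<and>
      j < nverts (kernel x) \<and>
     labels_adjacent (enc_cp_graph x) (labels (enc_cp_graph x) ! i) (labels (enc_cp_graph x) ! j)"
    (is "_ \<longleftrightarrow> ?i \<and> ?j \<and> ?adj i j")
proof
  assume "{i, j} \<in> edges (kernel x)"
  then obtain i' j' where "{i, j} = {i', j'}" "i' < j'" "j' < nverts (kernel x)" "?adj i' j'"
    unfolding kernel_simps(1,2) by blast
  moreover from this have "?adj j' i'"
    using labels_adjacent_sym by blast
  ultimately show "?i \<and> ?j \<and> ?adj i j"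
    by (auto simp: doubleton_eq_iff)
next
  assume ij: "?i \<and> ?j \<and> ?adj i j"
  then have "i \<noteq> j"
    by (auto simp: labels_adjacent_def)
  then consider "i < j" | "j < i" by linarith
  then show "{i, j} \<in> edges (kernel x)"
  proof cases
    case 1
    then show ?thesis
      using ij unfolding kernel_simps(1,2) by blast
  next
    case 2
    then have "{j, i} \<in> edges (kernel x)"
      using ij labels_adjacent_sym[of _ "labels (enc_cp_graph x) ! i"] unfolding kernel_simps(1,2) by blast
    then show ?thesis
      by (simp add: insert_commute)
  qed
qed

lemma kernel_edge_labels_iff:
  "{i, j} \<in> edges (kernel x) \<and> kernel_group x i = S \<and>
      kernel_group x j = T \<longleftrightarrow> i < nverts (kernel x) \<and> j < nverts (kernel x) \<and>
     labels_adjacent (enc_cp_graph x) (labels (enc_cp_graph x) ! i) (labels (enc_cp_graph x) ! j) \<and>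
     hd_tree (labels (enc_cp_graph x) ! i) = S \<and> hd_tree (labels (enc_cp_graph x) ! j) = T"
  unfolding kernel_edge_iff kernel_group_def by blast

lemma kernel_group_image: "kernel_group x ` {..<nverts (kernel x)} = set (tree_groups (enc_cp_graph x))"
proof -
  have "kernel_group x ` {..<nverts (kernel x)} = hd_tree ` set (labels (enc_cp_graph x))"
    unfolding set_conv_nth kernel_group_def kernel_simps by auto
  also have "\<dots> = set (tree_groups (enc_cp_graph x))"
  proof
    show "hd_tree ` set (labels (enc_cp_graph x)) \<subseteq> set (tree_groups (enc_cp_graph x))"
      by (auto simp: mem_labels)
    show "set (tree_groups (enc_cp_graph x)) \<subseteq> hd_tree ` set (labels (enc_cp_graph x))"
    proof
      fix S assume "S \<in> set (tree_groups (enc_cp_graph x))"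
      then have "label S S S (enc_nat 0) \<in> set (labels (enc_cp_graph x))"
        unfolding mem_labels by blast
      then show "S \<in> hd_tree ` set (labels (enc_cp_graph x))"
        by (metis hd_tree.simps(2) image_eqI)
    qed
  qed
  finally show ?thesis .
qed

text \<open>Two groups may be adjacent without any conflict, so the role 3 gadget has to realise the
  adjacency on its own.\<close>

lemma kernel_groups_adjacent:
  "groups_adjacent (edges (kernel x)) (kernel_group x) S T \<longleftrightarrow>
     S \<in> set (tree_groups (enc_cp_graph x)) \<and> T \<in> set (tree_groups (enc_cp_graph x)) \<and>
     tree_groups_adjacent (enc_cp_graph x) S T" (is "?lhs \<longleftrightarrow> ?rhs")
proof
  let ?L = "labels (enc_cp_graph x)"
  assume ?lhs
  then obtain i j where ij: "S \<noteq> T" "i < length ?L" "j < length ?L"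
      "labels_adjacent (enc_cp_graph x) (?L ! i) (?L ! j)" "S = hd_tree (?L ! i)" "T = hd_tree (?L ! j)"
    unfolding groups_adjacent_def kernel_edge_labels_iff kernel_simps(1) by blast
  then have "tree_groups_adjacent (enc_cp_graph x) S T"
    using labels_adjacent_groups_adjacent nth_mem by blast
  moreover have "S \<in> set (tree_groups (enc_cp_graph x))" "T \<in> set (tree_groups (enc_cp_graph x))"
    unfolding kernel_group_image[symmetric] using ij by (auto simp: kernel_group_def kernel_simps(1))
  ultimately show ?rhs by blast
next
  let ?L = "labels (enc_cp_graph x)"
  assume rhs: ?rhs
  then have "S \<noteq> T"
    by (simp add: tree_groups_adjacent_def)
  have "label S T T (enc_nat 3) \<in> set ?L" "label T S S (enc_nat 3) \<in> set ?L"
    using rhs unfolding mem_labels by blast+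
  then obtain i j where ij: "i < length ?L" "?L ! i = label S T T (enc_nat 3)"
      "j < length ?L" "?L ! j = label T S S (enc_nat 3)"
    by (metis in_set_conv_nth)
  have "labels_adjacent (enc_cp_graph x) (?L ! i) (?L ! j)"
    unfolding labels_adjacent_def ij label_arc_label using rhs \<open>S \<noteq> T\<close> by auto
  then show ?lhs
    unfolding groups_adjacent_def kernel_edge_labels_iff kernel_simps(1)
    using ij \<open>S \<noteq> T\<close> by (metis hd_tree.simps(2))
qed

text \<open>Vertices are positions, whereas gadgets are described by labels. Distinctness of the
  groups makes the labels distinct, so that two different neighbours are also two different
  labels.\<close>

lemma kernel_groups_conflict:
  assumes "distinct (tree_groups (enc_cp_graph x))"
  shows "groups_conflict (edges (kernel x)) (kernel_group x) S T U \<longleftrightarrow>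
     S \<in> set (tree_groups (enc_cp_graph x)) \<and> T \<in> set (tree_groups (enc_cp_graph x)) \<and>
     U \<in> set (tree_groups (enc_cp_graph x)) \<and>
         tree_groups_conflict (enc_cp_graph x) S T U" (is "?lhs \<longleftrightarrow> ?rhs")
proof
  let ?L = "labels (enc_cp_graph x)"
  assume ?lhs
  then obtain i j k where ij: "S \<noteq> T" "S \<noteq> U" "j \<noteq> k"
      "{i, j} \<in> edges (kernel x)" "{i, k} \<in> edges (kernel x)"
      "kernel_group x i = S" "kernel_group x j = T" "kernel_group x k = U"
    unfolding groups_conflict_def by blast
  then have i: "i < length ?L" "j < length ?L" "k < length ?L"
      "labels_adjacent (enc_cp_graph x) (?L ! i) (?L ! j)"
          "labels_adjacent (enc_cp_graph x) (?L ! i) (?L ! k)"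
    unfolding kernel_edge_iff kernel_simps(1) by blast+
  have "?L ! j \<noteq> ?L ! k"
    using distinct_labels[OF assms] i ij by (simp add: nth_eq_iff_index_eq)
  then have "tree_groups_conflict (enc_cp_graph x) S T U"
    using ij(1,2,6-8) i labels_adjacent_conflict[of "?L ! i" _ "?L ! j" "?L ! k"]
    unfolding kernel_group_def by simp
  moreover have "S \<in> set (tree_groups (enc_cp_graph x))"
      "T \<in> set (tree_groups (enc_cp_graph x))" "U \<in> set (tree_groups (enc_cp_graph x))"
    unfolding kernel_group_image[symmetric] using i ij(6-8) by (auto simp: kernel_simps(1))
  ultimately show ?rhs by blast
next
  let ?L = "labels (enc_cp_graph x)"
  assume rhs: ?rhs
  then have STU: "S \<noteq> T" "S \<noteq> U"
    by (simp_all add: tree_groups_conflict_def)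
  have "label S T U (enc_nat 0) \<in> set ?L" "label T S U (enc_nat 1) \<in> set ?L"
      "label U S T (enc_nat 2) \<in> set ?L"
    using rhs unfolding mem_labels by blast+
  then obtain i j k where ij: "i < length ?L" "?L ! i = label S T U (enc_nat 0)"
      "j < length ?L" "?L ! j = label T S U (enc_nat 1)" "k < length ?L" "?L ! k = label U S T (enc_nat 2)"
    by (metis in_set_conv_nth)
  have "labels_adjacent (enc_cp_graph x) (?L ! i) (?L ! j)"
      "labels_adjacent (enc_cp_graph x) (?L ! i) (?L ! k)"
    unfolding labels_adjacent_def ij label_arc_label using rhs STU by auto
  then have "{i, j} \<in> edges (kernel x)" "{i, k} \<in> edges (kernel x)"
    unfolding kernel_edge_iff kernel_simps(1) using ij by auto
  moreover have "j \<noteq> k"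
    \<comment> \<open>The roles 1 and 2 separate the two neighbours also in the case
      \<open>T = U\<close>.\<close>
    using ij(4,6) by (auto simp del: enc_nat.simps)
  moreover have "kernel_group x i = S" "kernel_group x j = T" "kernel_group x k = U"
    using ij by (simp_all add: kernel_group_def)
  ultimately show ?lhs
    unfolding groups_conflict_def using STU by blast
qed

lemma simple_graph_kernel: "simple_graph {..<nverts (kernel x)} (edges (kernel x))"
  unfolding simple_graph_def by (auto simp: kernel_simps(1,2) card_insert_if)

text \<open>The third vertex is found among the labels \<open>S S S\<close> with roles 0, 1 and 2:
  three distinct labels cannot all be among the two given ones.\<close>

lemma kernel_clique_grouping:
  assumes "distinct (tree_groups (enc_cp_graph x))"
  shows "clique_grouping {..<nverts (kernel x)} (edges (kernel x)) (kernel_group x)"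
  unfolding clique_grouping_def
proof (intro conjI simple_graph_kernel ballI impI)
  let ?L = "labels (enc_cp_graph x)"
  fix i j assume "i \<in> {..<nverts (kernel x)}" "j \<in> {..<nverts (kernel x)}" "i \<noteq> j"
    and same: "kernel_group x i = kernel_group x j"
  then have ij: "i < length ?L" "j < length ?L" "?L ! i \<noteq> ?L ! j"
    using distinct_labels[OF assms] by (simp_all add: kernel_simps(1) nth_eq_iff_index_eq)
  then show "{i, j} \<in> edges (kernel x)"
    using same unfolding kernel_edge_iff kernel_simps(1) labels_adjacent_def kernel_group_def by simp
  define S where "S = kernel_group x i"
  have S: "S \<in> set (tree_groups (enc_cp_graph x))"
    unfolding kernel_group_image[symmetric] S_def using ij by (simp add: kernel_simps(1))
  have "\<exists>r\<in>{0, 1, 2 :: nat}. f r \<noteq> l \<and>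
      f r \<noteq> l'" if "inj f" for f :: "nat \<Rightarrow> tree" and l l'
  proof -
    have "f 0 \<noteq> f 1" "f 0 \<noteq> f 2" "f 1 \<noteq> f 2"
      using that by (simp_all add: inj_eq)
    then show ?thesis
      unfolding bex_simps by metis
  qed
  moreover have "inj (\<lambda>r. label S S S (enc_nat r))"
    by (rule injI) simp
  ultimately have "\<exists>r\<in>{0, 1, 2 :: nat}. label S S S (enc_nat r) \<noteq> ?L ! i \<and>
      label S S S (enc_nat r) \<noteq> ?L ! j" .
  then obtain r where r: "r \<in> {0, 1, 2 :: nat}" "label S S S (enc_nat r) \<noteq> ?L ! i"
      "label S S S (enc_nat r) \<noteq> ?L ! j"
    by blast
  have "label S S S (enc_nat r) \<in> set ?L"
    unfolding mem_labels using S r(1) by blast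
  then obtain k where k: "k < length ?L" "?L ! k = label S S S (enc_nat r)"
    by (metis in_set_conv_nth)
  then show "\<exists>w\<in>{..<nverts (kernel x)}. w \<noteq> i \<and> w \<noteq> j \<and>
      kernel_group x w = kernel_group x i"
    using r(2,3) by (intro bexI[of _ k]) (auto simp: kernel_group_def kernel_simps(1) S_def[unfolded
        kernel_group_def])
qed

lemma kernel_clique_partition:
  assumes "distinct (tree_groups (enc_cp_graph x))"
  shows "clique_partition {..<nverts (kernel x)} (edges (kernel x)) (cliques (kernel x))"
proof -
  have "clique K (edges (kernel x))" if "K \<in> cliques (kernel x)" for K
    using that kernel_clique_grouping[OF assms] unfolding clique_def clique_grouping_def
        kernel_simps(3) by force
  moreover have "partition_on {..<nverts (kernel x)} (cliques (kernel x))"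
    unfolding kernel_simps(3) by (auto simp: partition_on_def disjoint_def)
  ultimately show ?thesis
    by (simp add: clique_partition_def)
qed


section \<open>Encodings of the instance and of the kernel\<close>

definition enc_set :: "nat set \<Rightarrow> tree" where
  "enc_set A = enc_list enc_nat (sorted_list_of_set A)"

lemma list_of_enc_set: "finite A \<Longrightarrow> set (list_of_tree (enc_set A)) = enc_nat ` A"
  by (simp add: enc_set_def)

lemma enc_set_eq_iff: "finite A \<Longrightarrow> finite B \<Longrightarrow>
    enc_set A = enc_set B \<longleftrightarrow> A = B"
  unfolding enc_set_def by (metis enc_list_inj enc_nat_inj set_sorted_list_of_set)

lemma enc_set_singleton: "enc_set {v} = Pr (enc_nat v) Nl"
  by (simp add: enc_set_def)

lemma set_list_of_enc_family:
  assumes "finite F"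
  shows "set (list_of_tree (enc_family F)) = enc_set ` F"
  using assms by (simp add: enc_family_def enc_set_def image_image)

text \<open>Turns the order of a scan into the sortedness that identifies its output as a canonical
  encoding.\<close>

lemma sorted_wrt_concat_upt:
  assumes "\<And>i. i < n \<Longrightarrow> sorted_wrt P (f i)"
    and "\<And>i j x y. i < j \<Longrightarrow> j < n \<Longrightarrow>
        x \<in> set (f i) \<Longrightarrow> y \<in> set (f j) \<Longrightarrow> P x y"
  shows "sorted_wrt P (concat (map f [0..<n]))"
  using assms
proof (induction n)
  case (Suc n)
  then have "sorted_wrt P (concat (map f [0..<n]))"
    by simp
  with Suc.prems show ?case
    by (auto simp: sorted_wrt_append)
qed simp

lemma sorted_list_of_set_eqI:
  fixes xs :: "'a :: linorder list"
  assumes "sorted_wrt (<) xs" "set xs = A"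
  shows "sorted_list_of_set A = xs"
  using assms by (metis sorted_list_of_set.idem_if_sorted_distinct strict_sorted_iff)

lemma enc_set_doubleton: "u < v \<Longrightarrow> enc_set {u, v} = Pr (enc_nat u) (Pr (enc_nat v) Nl)"
  using sorted_list_of_set_eqI[of "[u, v]" "{u, v}"] by (simp add: enc_set_def)

lemma enc_family_eqI:
  assumes "sorted_wrt (<) xss" "set xss = sorted_list_of_set ` F"
  shows "enc_family F = enc_list (enc_list enc_nat) xss"
  unfolding enc_family_def using sorted_list_of_set_eqI[OF assms] by simp

lemma map_concat_map: "map f (concat (map g xs)) = concat (map (\<lambda>x. map f (g x)) xs)"
  by (induction xs) auto

lemma enc_kernel_edges: "enc_family (edges (kernel x)) = tree_of_list (kernel_edges (enc_cp_graph x))"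
proof -
  define a where "a = enc_cp_graph x"
  define N where "N = length (labels a)"
  define C where "C = (\<lambda>i j. i < j \<and> labels_adjacent a (labels a ! i) (labels a ! j))"
  \<comment> \<open>The comprehension of \<open>kernel_edges\<close>, over lists of numbers instead
    of trees.\<close>
  define xss where "xss = concat (map (\<lambda>i. concat (map (\<lambda>j.
      if C i j then [[i, j]] else []) [0..<N])) [0..<N])"
  have "sorted_wrt (<) xss"
    unfolding xss_def by (intro sorted_wrt_concat_upt) (auto split: if_splits)
  moreover have "set xss = sorted_list_of_set ` edges (kernel x)"
  proof -
    have pair: "sorted_list_of_set {i, j} = [i, j]" if "i < j" for i j :: nat
      using that by (intro sorted_list_of_set_eqI) auto
    define D where "D = {(i, j). i < N \<and> j < N \<and> C i j}"
    have "edges (kernel x) = (\<lambda>(i, j). {i, j}) ` D"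
      unfolding kernel_simps(2) D_def C_def N_def a_def by (force simp: image_iff)
    then have "sorted_list_of_set ` edges (kernel x) =
        (\<lambda>p. sorted_list_of_set (case p of (i, j) \<Rightarrow> {i, j})) ` D"
      by (simp only: image_image)
    also have "\<dots> = (\<lambda>(i, j). [i, j]) ` D"
      by (intro image_cong refl) (auto simp: pair D_def C_def)
    finally have "sorted_list_of_set ` edges (kernel x) = (\<lambda>(i, j). [i, j]) ` D" .
    moreover have "set xss = (\<lambda>(i, j). [i, j]) ` D"
      unfolding xss_def D_def by (force split: if_splits)
    ultimately show ?thesis by simp
  qed
  ultimately have "enc_family (edges (kernel x)) = enc_list (enc_list enc_nat) xss"
    by (rule enc_family_eqI)
  also have "\<dots> = tree_of_list (kernel_edges a)"
    unfolding enc_list_conv_map[of "enc_list enc_nat"] xss_def kernel_edges_def map_concat_map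
    by (simp add: C_def N_def if_distrib cong: if_cong)
  finally show ?thesis by (simp add: a_def)
qed

lemma enc_kernel_cliques: "enc_family (cliques (kernel x)) = tree_of_list (kernel_cliques (enc_cp_graph x))"
proof -
  define a where "a = enc_cp_graph x"
  define N where "N = length (labels a)"
  define h where "h = (\<lambda>i. hd_tree (labels a ! i))"
  define block where "block = (\<lambda>i. filter (\<lambda>j. h j = h i) [0..<N])"
  define C where "C = (\<lambda>i. \<exists>j<i. h j = h i)"
  define xss where "xss = concat (map (\<lambda>i. if C i then [] else [block i]) [0..<N])"
  \<comment> \<open>A block emitted at \<open>i\<close> begins with \<open>i\<close>, so the
    lexicographic comparison of two emitted blocks is decided by their first entries.\<close>
  have block: "\<exists>ys. block i = i # ys" if "i < N" "\<not> C i" for i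
  proof -
    have "[0..<N] = [0..<i] @ i # [Suc i..<N]"
      using that(1) upt_add_eq_append[of 0 i "N - i"] by (simp add: upt_conv_Cons)
    moreover have "filter (\<lambda>j. h j = h i) [0..<i] = []"
      using that(2) by (auto simp: C_def filter_empty_conv)
    ultimately show ?thesis
      by (simp add: block_def)
  qed
  have "sorted_wrt (<) xss"
    unfolding xss_def
  proof (intro sorted_wrt_concat_upt)
    fix i j ys zs
    assume "i < j" "j < N" "ys \<in> set (if C i then [] else [block i])"
        "zs \<in> set (if C j then [] else [block j])"
    then show "ys < zs"
      using block[of i] block[of j] by (auto split: if_splits)
  qed simp
  moreover have "set xss = sorted_list_of_set ` cliques (kernel x)"
  proof -
    have sorted: "sorted_list_of_set {j. j < N \<and> h j = h i} = block i" for i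
      by (rule sorted_list_of_set_eqI) (auto simp: block_def intro: sorted_wrt_filter)
    have "sorted_list_of_set ` cliques (kernel x) = block ` {..<N}"
      unfolding kernel_simps image_image kernel_group_def
      using sorted by (simp add: h_def N_def a_def)
    moreover have "set xss = block ` {..<N}"
    proof
      have "set (if C i then [] else [block i]) \<subseteq> block ` {..<N}" if "i < N" for i
        using that by simp
      then show "set xss \<subseteq> block ` {..<N}"
        by (fastforce simp: xss_def)
      show "block ` {..<N} \<subseteq> set xss"
      proof
        fix ys assume "ys \<in> block ` {..<N}"
        then obtain i where i: "i < N" "ys = block i" by auto
        \<comment> \<open>The least member of the clique of \<open>i\<close> is the index at which
          its block is emitted.\<close>
        define m where "m = (LEAST j. h j = h i)"
        have m: "h m = h i" "m \<le> i"
          unfolding m_def by (rule LeastI[of _ i], simp) (rule Least_le, simp)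
        have "m \<le> j" if "h j = h i" for j
          unfolding m_def using that by (rule Least_le)
        then have "\<not> C m"
          unfolding C_def m(1) by (meson leD)
        moreover have "ys = block m"
          using i m by (simp add: block_def)
        ultimately show "ys \<in> set xss"
          unfolding xss_def using i(1) m(2) by simp (rule bexI[of _ m], simp_all)
      qed
    qed
    ultimately show ?thesis by simp
  qed
  ultimately have "enc_family (cliques (kernel x)) = enc_list (enc_list enc_nat) xss"
    by (rule enc_family_eqI)
  also have "\<dots> = tree_of_list (kernel_cliques a)"
  proof -
    have C: "(\<exists>j<length (labels a). tree_less (enc_nat j) (enc_nat i) \<and>
        hd_tree (labels a ! j) = hd_tree (labels a ! i)) \<longleftrightarrow> C i"
      if "i < N" for i
      using that less_trans by (fastforce simp: C_def h_def N_def)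
    have B: "tree_of_list (concat (map (\<lambda>j.
        if hd_tree (labels a ! j) = hd_tree (labels a ! i) then [enc_nat j] else [])
        [0..<length (labels a)])) = enc_list enc_nat (block i)" for i
    proof -
      have "concat (map (\<lambda>j. if P j then [f j] else []) js) = map f (filter P js)" for P
          and f :: "nat \<Rightarrow> tree" and js
        by (induction js) auto
      then show ?thesis
        unfolding enc_list_conv_map[of enc_nat] block_def h_def N_def by simp
    qed
    have "map (enc_list enc_nat) xss = kernel_cliques a"
      unfolding xss_def kernel_cliques_def map_concat_map B
    proof (intro arg_cong[where f = concat] map_cong)
      fix i assume "i \<in> set [0..<length (labels a)]"
      then have i: "i < N" by (simp add: N_def)
      show "map (enc_list enc_nat) (if C i then [] else [block i]) =
          (if \<exists>j<length (labels a). tree_less (enc_nat j) (enc_nat i) \<and>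
              hd_tree (labels a ! j) = hd_tree (labels a ! i)
           then [] else [enc_list enc_nat (block i)])"
        unfolding C[OF i] by simp
    qed (simp add: N_def)
    then show ?thesis
      unfolding enc_list_conv_map[of "enc_list enc_nat"] by simp
  qed
  finally show ?thesis by (simp add: a_def)
qed

lemma enc_kernel: "enc_cp_graph (kernel x) = kernel_tree (enc_cp_graph x)"
proof -
  have "tl_tree (tl_tree (tl_tree (enc_cp_graph x))) = enc_nat (bound x)"
    by (simp add: enc_cp_graph_def)
  moreover have "tree_of_list (list_of_tree (enc_nat k) @ list_of_tree (enc_nat k)) = enc_nat (2 * k)" for k
    by (simp only: list_of_enc_nat replicate_add[symmetric] tree_of_replicate mult_2)
  ultimately show ?thesis
    unfolding kernel_tree_def enc_cp_graph_def[of "kernel x"] kernel_simps(1,4) enc_kernel_edges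
        enc_kernel_cliques
    by simp
qed

section \<open>The groups of the input graph and their encodings\<close>

definition groups :: "cp_graph \<Rightarrow> nat set set" where
  "groups x = (\<Union>K\<in>cliques x. if 3 \<le> card K then {K} else (\<lambda>v. {v}) ` K)"

lemma cp_graphD:
  assumes "x \<in> cp_graphs"
  shows "simple_graph {..<nverts x} (edges x)" "partition_on {..<nverts x} (cliques x)"
    "\<And>K. K \<in> cliques x \<Longrightarrow> clique K (edges x)" "card (cliques x) \<le> bound x"
    "finite (cliques x)" "\<And>K. K \<in> cliques x \<Longrightarrow>
        finite K" "finite (edges x)" "\<And>e. e \<in> edges x \<Longrightarrow> finite e"
proof -
  show *: "simple_graph {..<nverts x} (edges x)" "partition_on {..<nverts x} (cliques x)"
    "\<And>K. K \<in> cliques x \<Longrightarrow> clique K (edges x)" "card (cliques x) \<le> bound x"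
    using assms by (auto simp: cp_graphs_def clique_partition_def)
  show "finite (cliques x)"
    using *(2) finite_elements by blast
  show "finite K" if "K \<in> cliques x" for K
    using *(2) that unfolding partition_on_def by (metis Union_upper finite_lessThan finite_subset)
  have "edges x \<subseteq> Pow {..<nverts x}"
    using *(1) by (auto simp: simple_graph_def)
  then show "finite (edges x)" "\<And>e. e \<in> edges x \<Longrightarrow> finite e"
    by (meson PowD finite_Pow_iff finite_lessThan finite_subset subsetD)+
qed

lemma tree_groups_enc:
  assumes x: "x \<in> cp_graphs"
  shows "distinct (tree_groups (enc_cp_graph x))" "set (tree_groups (enc_cp_graph x)) = enc_set ` groups x"
    "length (tree_groups (enc_cp_graph x)) \<le> 2 * bound x"
proof -
  define Ks where "Ks = map set (sorted_list_of_set (sorted_list_of_set ` cliques x))"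
  have "set ` sorted_list_of_set ` cliques x = (\<lambda>K. K) ` cliques x"
    unfolding image_image by (intro image_cong) (simp_all add: cp_graphD[OF x])
  then have Ks: "set Ks = cliques x"
    by (simp add: Ks_def cp_graphD[OF x])
  have "inj_on set (sorted_list_of_set ` cliques x)"
    by (intro inj_onI) (metis (no_types, lifting) imageE cp_graphD(6)[OF x] set_sorted_list_of_set)
  then have distinct: "distinct Ks"
    by (simp add: Ks_def distinct_map cp_graphD[OF x])
  define f where "f = (\<lambda>K :: nat set.
      if 3 \<le> card K then [K] else map (\<lambda>v. {v}) (sorted_list_of_set K))"
  define gs where "gs = concat (map f Ks)"
  have set_f: "set (f K) = (if 3 \<le> card K then {K} else (\<lambda>v. {v}) ` K)"
      if "K \<in> cliques x" for K
    using cp_graphD(6)[OF x that] by (simp add: f_def)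
  have trees: "tree_groups (enc_cp_graph x) = map enc_set gs"
  proof -
    have cl: "list_of_tree (hd_tree (tl_tree (tl_tree (enc_cp_graph x)))) = map enc_set Ks"
    proof -
      have "enc_list enc_nat ys = enc_set (set ys)"
          if "ys \<in> set (sorted_list_of_set (sorted_list_of_set ` cliques x))" for ys
      proof -
        obtain K where "ys = sorted_list_of_set K" "finite K"
          using \<open>ys \<in> _\<close> by (auto simp: cp_graphD[OF x])
        then show ?thesis by (simp add: enc_set_def)
      qed
      then show ?thesis
        by (simp add: enc_cp_graph_def enc_family_def Ks_def)
    qed
    have "(if tl_tree (tl_tree (enc_set K)) \<noteq> Nl then [enc_set K] else map (\<lambda>v. Pr v
        Nl) (list_of_tree (enc_set K))) = map enc_set (f K)"
      if "K \<in> set Ks" for K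
    proof -
      have long: "tl_tree (tl_tree (enc_list e xs)) \<noteq> Nl \<longleftrightarrow>
          3 \<le> length xs" for e and xs :: "nat list"
        by (cases xs; cases "tl xs"; cases "tl (tl xs)") auto
      show ?thesis
        using cp_graphD(6)[OF x] that Ks by (simp add: enc_set_def[of K] long f_def enc_set_singleton)
    qed
    then show ?thesis
      unfolding tree_groups_def cl gs_def map_concat_map by (simp add: comp_def cong: map_cong)
  qed
  have gs: "set gs = groups x"
    using set_f by (simp add: gs_def groups_def Ks)
  have fin: "finite S" if "S \<in> groups x" for S
    using that cp_graphD(6)[OF x] by (auto simp: groups_def split: if_splits)
  have "distinct gs"
    unfolding gs_def
  proof (rule distinct_concat_map[OF distinct])
    show "distinct (f K)" for K
      by (simp add: f_def distinct_map)
    fix K K' assume K: "K \<in> set Ks" "K' \<in> set Ks" "K \<noteq> K'"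
    have "K \<inter> K' = {}"
      using K cp_graphD(2)[OF x] unfolding Ks partition_on_def by (auto simp: disjoint_def)
    moreover have "S \<subseteq> K \<and> S \<noteq> {}" if "S \<in> set (f K)" "K \<in> set Ks" for S K
      using that cp_graphD(2)[OF x] unfolding Ks partition_on_def by (auto simp: set_f split: if_splits)
    ultimately show "set (f K) \<inter> set (f K') = {}"
      using K by blast
  qed
  then show "distinct (tree_groups (enc_cp_graph x))"
    using enc_set_eq_iff fin by (auto simp: trees distinct_map gs inj_on_def)
  show "set (tree_groups (enc_cp_graph x)) = enc_set ` groups x"
    by (simp add: trees gs)
  \<comment> \<open>A clique contributes itself or at most two singletons; this is the origin of the
    factor 2 in the new parameter.\<close>
  have "length (f K) \<le> 2" for K
    by (simp add: f_def)
  then have "length gs \<le> 2 * length Ks"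
    unfolding gs_def by (induction Ks) (auto intro: add_mono order.trans)
  moreover have "length Ks = card (cliques x)"
    using distinct Ks distinct_card by fastforce
  ultimately show "length (tree_groups (enc_cp_graph x)) \<le> 2 * bound x"
    using cp_graphD(4)[OF x] by (simp add: trees)
qed

lemma groups_partition:
  assumes x: "x \<in> cp_graphs"
  shows "\<Union> (groups x) = {..<nverts x}"
    "\<And>S T v. S \<in> groups x \<Longrightarrow> T \<in> groups x \<Longrightarrow>
        v \<in> S \<Longrightarrow> v \<in> T \<Longrightarrow> S = T"
    "\<And>S. S \<in> groups x \<Longrightarrow> finite S \<and> S \<noteq> {}"
    "\<And>S. S \<in> groups x \<Longrightarrow> card S = 1 \<or> 3 \<le> card S \<and> clique S (edges x)"
proof -
  have U: "\<Union> (cliques x) = {..<nverts x}" and "disjoint (cliques x)" and ne: "{} \<notin> cliques x"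
    using cp_graphD(2)[OF x] by (auto simp: partition_on_def)
  then have disj: "K = L" if "K \<in> cliques x" "L \<in> cliques x" "v \<in> K" "v \<in> L" for K L v
    using that by (meson disjointD disjoint_iff)
  have sub: "\<exists>K\<in>cliques x. S \<subseteq> K \<and> S \<noteq> {} \<and>
      (if 3 \<le> card K then S = K else card S = 1)" if S: "S \<in> groups x" for S
  proof -
    obtain K where K: "K \<in> cliques x" "S \<in> (if 3 \<le> card K then {K} else (\<lambda>v. {v}) ` K)"
      using S unfolding groups_def by blast
    moreover from this have "K \<noteq> {}" using ne by blast
    ultimately show ?thesis by (intro bexI[of _ K]) (auto split: if_splits)
  qed
  have "\<Union> (if 3 \<le> card K then {K} else (\<lambda>v. {v}) ` K) = K" for K :: "nat set"
    by simp
  then show "\<Union> (groups x) = {..<nverts x}"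
    unfolding groups_def U[symmetric] by blast
  show "finite S \<and> S \<noteq> {}" if "S \<in> groups x" for S
    using sub[OF that] cp_graphD(6)[OF x] finite_subset by blast
  show "card S = 1 \<or> 3 \<le> card S \<and> clique S (edges x)" if "S \<in> groups x" for S
    using sub[OF that] cp_graphD(3)[OF x] by (metis (full_types))
  show "S = T" if S: "S \<in> groups x" and T: "T \<in> groups x" and v: "v \<in> S" "v \<in> T" for S T v
  proof -
    obtain K where K: "K \<in> cliques x" "S \<subseteq> K" "if 3 \<le> card K then S = K else card S = 1"
      using sub[OF S] by blast
    obtain L where L: "L \<in> cliques x" "T \<subseteq> L" "if 3 \<le> card L then T = L else card T = 1"
      using sub[OF T] by blast
    have "K = L"
      using disj[of K L v] K L v by blast
    then show ?thesis
      using K(3) L(3) v by (auto split: if_splits simp: card_1_singleton_iff)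
  qed
qed

text \<open>Groups are named by their trees, the same names that head the kernel labels, so both
  graphs are grouped over one index set.\<close>

definition input_group :: "cp_graph \<Rightarrow> nat \<Rightarrow> tree" where
  "input_group x v = enc_set (THE S. S \<in> groups x \<and> v \<in> S)"

lemma input_group_eq:
  assumes "x \<in> cp_graphs" "S \<in> groups x" "v \<in> S"
  shows "input_group x v = enc_set S"
proof -
  have "(THE S. S \<in> groups x \<and> v \<in> S) = S"
    using assms groups_partition(2)[OF assms(1)] by (intro the_equality) auto
  then show ?thesis by (simp add: input_group_def)
qed

lemma input_group_iff:
  assumes "x \<in> cp_graphs" "S \<in> groups x" "v < nverts x"
  shows "input_group x v = enc_set S \<longleftrightarrow> v \<in> S"
proof -
  obtain T where T: "T \<in> groups x" "v \<in> T"
    using assms(3) groups_partition(1)[OF assms(1)] by blast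
  then show ?thesis
    using input_group_eq[OF assms(1) T] assms(2) groups_partition(2,3)[OF assms(1)] enc_set_eq_iff by metis
qed

lemma input_group_image:
  assumes x: "x \<in> cp_graphs"
  shows "input_group x ` {..<nverts x} = set (tree_groups (enc_cp_graph x))"
proof -
  have "input_group x ` \<Union> (groups x) = enc_set ` groups x"
    using input_group_eq[OF x] groups_partition(3)[OF x] by (auto simp: image_iff) blast+
  then show ?thesis
    by (simp add: groups_partition(1)[OF x] tree_groups_enc(2)[OF x])
qed

text \<open>Two distinct vertices in one group exclude a singleton, so the group is an unsplit
  clique with at least three vertices and supplies the third one.\<close>

lemma input_clique_grouping:
  assumes x: "x \<in> cp_graphs"
  shows "clique_grouping {..<nverts x} (edges x) (input_group x)"
  unfolding clique_grouping_def
proof (intro conjI cp_graphD(1)[OF x] ballI impI)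
  fix u v assume uv: "u \<in> {..<nverts x}" "v \<in> {..<nverts x}" "u \<noteq> v"
      "input_group x u = input_group x v"
  obtain S where S: "S \<in> groups x" "u \<in> S"
    using uv groups_partition(1)[OF x] by blast
  then have "v \<in> S"
    using input_group_iff[OF x S(1), of v] input_group_eq[OF x S] uv by simp
  then have "card S \<noteq> 1"
    using S uv by (auto simp: card_1_singleton_iff)
  then have card: "3 \<le> card S" "clique S (edges x)"
    using groups_partition(4)[OF x S(1)] by auto
  then show "{u, v} \<in> edges x"
    using S \<open>v \<in> S\<close> uv unfolding clique_def by blast
  have "\<not> S \<subseteq> {u, v}"
    using card card_mono[of "{u, v}" S] uv(3) by auto
  then obtain w where "w \<in> S" "w \<noteq> u" "w \<noteq> v" by auto
  moreover from this have "w < nverts x" "input_group x w = input_group x u"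
    using S groups_partition(1)[OF x] input_group_eq[OF x S(1)] by auto
  ultimately show "\<exists>w\<in>{..<nverts x}. w \<noteq> u \<and> w \<noteq> v \<and>
      input_group x w = input_group x u"
    by auto
qed

lemma tree_edges_enc:
  assumes "x \<in> cp_graphs"
  shows "set (tree_edges (enc_cp_graph x)) = enc_set ` edges x"
  using set_list_of_enc_family[OF cp_graphD(7)[OF assms]] by (simp add: tree_edges_def enc_cp_graph_def)

lemma edge_ordered:
  assumes "simple_graph V E" "e \<in> E"
  obtains u v :: nat where "e = {u, v}" "u < v"
proof -
  obtain u v where "e = {u, v}" "u \<noteq> v"
    using simple_graph_edgeE[OF assms] by metis
  then show thesis
    using that[of u v] that[of v u] by (cases u v rule: linorder_cases) (auto simp: insert_commute)
qed

lemma tree_adjacent_enc: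
  assumes x: "x \<in> cp_graphs"
  shows "tree_adjacent (enc_cp_graph x) (enc_nat u) (enc_nat v) \<longleftrightarrow> {u, v} \<in> edges x"
proof
  assume "tree_adjacent (enc_cp_graph x) (enc_nat u) (enc_nat v)"
  then obtain e where e: "e \<in> edges x" "enc_set e =
      Pr (enc_nat u) (Pr (enc_nat v) Nl) \<or> enc_set e = Pr (enc_nat v) (Pr (enc_nat u) Nl)"
    unfolding tree_adjacent_def tree_edges_enc[OF x] by auto
  then obtain p q where "e = {p, q}" "p < q"
    using edge_ordered cp_graphD(1)[OF x] by blast
  then have "e = {u, v}"
    using e(2) by (auto simp: enc_set_doubleton)
  then show "{u, v} \<in> edges x"
    using e by simp
next
  assume uv: "{u, v} \<in> edges x"
  then have "u \<noteq> v"
    using simple_graph_edge(3)[OF cp_graphD(1)[OF x]] by blast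
  then have "enc_set {u, v} = Pr (enc_nat u) (Pr (enc_nat v) Nl) \<or> enc_set {u, v} =
      Pr (enc_nat v) (Pr (enc_nat u) Nl)"
    using enc_set_doubleton[of u v] enc_set_doubleton[of v u]
        by (cases u v rule: linorder_cases) (auto simp: insert_commute)
  then show "tree_adjacent (enc_cp_graph x) (enc_nat u) (enc_nat v)"
    unfolding tree_adjacent_def tree_edges_enc[OF x] using uv by blast
qed

text \<open>The right-hand side is that of \<open>kernel_groups_adjacent\<close>, so instance and
  kernel have the same adjacency relation on groups. Conflicts are compared in the same way.\<close>

lemma input_groups_adjacent:
  assumes x: "x \<in> cp_graphs"
  shows "groups_adjacent (edges x) (input_group x) S T \<longleftrightarrow>
     S \<in> set (tree_groups (enc_cp_graph x)) \<and> T \<in> set (tree_groups (enc_cp_graph x)) \<and>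
     tree_groups_adjacent (enc_cp_graph x) S T" (is "?lhs \<longleftrightarrow> ?rhs")
proof
  note edge = simple_graph_edge[OF cp_graphD(1)[OF x]]
  assume ?lhs
  then obtain u v where uv: "S \<noteq> T" "{u, v} \<in> edges x" "input_group x u = S" "input_group x v = T"
    by (auto simp: groups_adjacent_def)
  have V: "u < nverts x" "v < nverts x"
    using edge[OF uv(2)] by auto
  then have "S \<in> set (tree_groups (enc_cp_graph x))" "T \<in> set (tree_groups (enc_cp_graph x))"
    using uv input_group_image[OF x] by auto
  moreover from this obtain A B where AB: "S = enc_set A" "A \<in> groups x" "T =
      enc_set B" "B \<in> groups x"
    unfolding tree_groups_enc(2)[OF x] by auto
  moreover have "u \<in> A" "v \<in> B"
    using uv AB V input_group_iff[OF x] by auto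
  ultimately show ?rhs
    unfolding tree_groups_adjacent_def using uv groups_partition(3)[OF x] tree_adjacent_enc[OF x]
    by (auto simp: list_of_enc_set)
next
  assume rhs: ?rhs
  then obtain A B where AB: "S = enc_set A" "A \<in> groups x" "T = enc_set B" "B \<in> groups x"
    unfolding tree_groups_enc(2)[OF x] by auto
  then obtain u v where "S \<noteq> T" "u \<in> A" "v \<in> B" "{u, v} \<in> edges x"
    using rhs groups_partition(3)[OF x] tree_adjacent_enc[OF x]
    unfolding tree_groups_adjacent_def by (auto simp: list_of_enc_set)
  then show ?lhs
    unfolding groups_adjacent_def using AB input_group_eq[OF x] by blast
qed

lemma input_groups_conflict:
  assumes x: "x \<in> cp_graphs"
  shows "groups_conflict (edges x) (input_group x) S T U \<longleftrightarrow>
     S \<in> set (tree_groups (enc_cp_graph x)) \<and> T \<in> set (tree_groups (enc_cp_graph x)) \<and>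
     U \<in> set (tree_groups (enc_cp_graph x)) \<and>
         tree_groups_conflict (enc_cp_graph x) S T U" (is "?lhs \<longleftrightarrow> ?rhs")
proof
  note edge = simple_graph_edge[OF cp_graphD(1)[OF x]]
  assume ?lhs
  then obtain u v w where uv: "S \<noteq> T" "S \<noteq> U" "v \<noteq> w" "{u, v} \<in> edges x"
      "{u, w} \<in> edges x"
      "input_group x u = S" "input_group x v = T" "input_group x w = U"
    by (auto simp: groups_conflict_def)
  have V: "u < nverts x" "v < nverts x" "w < nverts x"
    using edge[OF uv(4)] edge[OF uv(5)] by auto
  then have G: "S \<in> set (tree_groups (enc_cp_graph x))" "T \<in> set (tree_groups (enc_cp_graph x))"
      "U \<in> set (tree_groups (enc_cp_graph x))"
    using uv input_group_image[OF x] by auto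
  then obtain A B C where AB: "S = enc_set A" "A \<in> groups x" "T =
      enc_set B" "B \<in> groups x" "U = enc_set C" "C \<in> groups x"
    unfolding tree_groups_enc(2)[OF x] by auto
  moreover have "u \<in> A" "v \<in> B" "w \<in> C"
    using uv AB V input_group_iff[OF x] by auto
  ultimately have "enc_nat u \<in> set (list_of_tree S)" "enc_nat v \<in> set (list_of_tree T)"
      "enc_nat w \<in> set (list_of_tree U)"
    using groups_partition(3)[OF x] by (auto simp: list_of_enc_set)
  moreover have "enc_nat v \<noteq> enc_nat w"
    using uv by simp
  ultimately show ?rhs
    unfolding tree_groups_conflict_def using G uv(1,2) uv(4,5)[folded tree_adjacent_enc[OF x]] by blast
next
  assume rhs: ?rhs
  then obtain A B C where AB: "S = enc_set A" "A \<in> groups x" "T =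
      enc_set B" "B \<in> groups x" "U = enc_set C" "C \<in> groups x"
    unfolding tree_groups_enc(2)[OF x] by auto
  then obtain u v w where "S \<noteq> T" "S \<noteq> U" "v \<noteq> w" "u \<in> A" "v \<in> B"
      "w \<in> C" "{u, v} \<in> edges x" "{u, w} \<in> edges x"
    using rhs groups_partition(3)[OF x] tree_adjacent_enc[OF x]
    unfolding tree_groups_conflict_def by (auto simp: list_of_enc_set)
  moreover from this have "input_group x u = S" "input_group x v = T" "input_group x w = U"
    using AB input_group_eq[OF x] by auto
  ultimately show ?lhs
    unfolding groups_conflict_def by blast
qed


section \<open>The bijective kernel\<close>

lemma kernel_in_cp_graphs:
  assumes x: "x \<in> cp_graphs"
  shows "kernel x \<in> cp_graphs"
proof -
  have "card (cliques (kernel x)) \<le> card (set (tree_groups (enc_cp_graph x)))"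
    unfolding kernel_simps(3) kernel_group_image by (rule card_image_le) simp
  also have "\<dots> \<le> 2 * bound x"
    using card_length tree_groups_enc(3)[OF x] le_trans by blast
  finally show ?thesis
    using simple_graph_kernel kernel_clique_partition[OF tree_groups_enc(1)[OF x]]
    by (simp add: cp_graphs_def kernel_simps(4))
qed

text \<open>Four roles for each of at most (2k)^3 triples give the factor 4 * 8 = 32.\<close>

lemma nverts_kernel_le:
  assumes x: "x \<in> cp_graphs"
  shows "nverts (kernel x) \<le> 32 * bound x ^ 3"
proof -
  have "length (tree_groups (enc_cp_graph x)) ^ 3 \<le> (2 * bound x) ^ 3"
    by (rule power_mono[OF tree_groups_enc(3)[OF x]]) simp
  then show ?thesis
    by (simp add: kernel_simps(1) length_labels power_mult_distrib)
qed

definition lift_cut :: "cp_graph \<Rightarrow> nat set set \<Rightarrow> nat set set" where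
  "lift_cut x = transfer_cut (edges x) (input_group x) (kernel_group x)"

lemma lift_cut_bij:
  assumes x: "x \<in> cp_graphs"
  shows "bij_betw (lift_cut x) (matching_cuts {..<nverts (kernel x)} (edges (kernel x)))
      (matching_cuts {..<nverts x} (edges x))"
    "bij_betw (lift_cut x) (minimal_matching_cuts {..<nverts (kernel x)} (edges (kernel x)))
        (minimal_matching_cuts {..<nverts x} (edges x))"
    "bij_betw (lift_cut x) (maximal_matching_cuts {..<nverts (kernel x)} (edges (kernel x)))
        (maximal_matching_cuts {..<nverts x} (edges x))"
proof -
  note distinct = tree_groups_enc(1)[OF x]
  have adj: "groups_adjacent (edges x) (input_group x) = groups_adjacent (edges (kernel x)) (kernel_group x)"
    using input_groups_adjacent[OF x] kernel_groups_adjacent by (intro ext) simp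
  have conf: "groups_conflict (edges x) (input_group x) = groups_conflict (edges (kernel x)) (kernel_group x)"
    using input_groups_conflict[OF x] kernel_groups_conflict[OF distinct] by (intro ext) simp
  have image: "input_group x ` {..<nverts x} = kernel_group x ` {..<nverts (kernel x)}"
    by (simp add: input_group_image[OF x] kernel_group_image)
  note grouped = input_clique_grouping[OF x] kernel_clique_grouping[OF distinct] image adj conf
  show "bij_betw (lift_cut x) (matching_cuts {..<nverts (kernel x)} (edges (kernel x)))
      (matching_cuts {..<nverts x} (edges x))"
    "bij_betw (lift_cut x) (minimal_matching_cuts {..<nverts (kernel x)} (edges (kernel x)))
        (minimal_matching_cuts {..<nverts x} (edges x))"
    "bij_betw (lift_cut x) (maximal_matching_cuts {..<nverts (kernel x)} (edges (kernel x)))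
        (maximal_matching_cuts {..<nverts x} (edges x))"
    unfolding lift_cut_def
    by (rule transfer_cut_bij(1)[OF grouped] transfer_cut_bij_extremal[OF grouped])+
qed

text \<open>The program tests whether endpoints belong to groups, whereas
  \<open>transfer_cut\<close> compares names of groups. Both agree because the groups partition the
  vertices and are determined by their encodings.\<close>

lemma enc_lift_cut:
  assumes x: "x \<in> cp_graphs" and M: "M \<subseteq> edges (kernel x)"
  shows "enc_family (lift_cut x M) = tree_of_list (lift_edges (enc_cp_graph x) (enc_family M))"
proof -
  let ?a = "enc_cp_graph x"
  let ?L = "labels ?a"
  define sel where "sel = (\<lambda>e. \<exists>f\<in>set (list_of_tree (enc_family M)).
     \<exists>i<length ?L. \<exists>j<length ?L. f = Pr (enc_nat i) (Pr (enc_nat j) Nl) \<and>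
       (hd_tree e \<in> set (list_of_tree (hd_tree (?L ! i))) \<and>
          hd_tree (tl_tree e) \<in> set (list_of_tree (hd_tree (?L ! j))) \<or>
        hd_tree e \<in> set (list_of_tree (hd_tree (?L ! j))) \<and>
          hd_tree (tl_tree e) \<in> set (list_of_tree (hd_tree (?L ! i)))))"
  define es where "es = sorted_list_of_set (sorted_list_of_set ` edges x)"
  have es: "set es = sorted_list_of_set ` edges x"
    by (simp add: es_def cp_graphD(7)[OF x])
  have edges: "tree_edges ?a = map (enc_list enc_nat) es"
    by (simp add: tree_edges_def enc_cp_graph_def enc_family_def es_def)
  have finM: "finite M"
    using M cp_graphD(7)[OF kernel_in_cp_graphs[OF x]] by (rule finite_subset)
  have mem: "enc_nat u \<in> set (list_of_tree (hd_tree (?L ! i))) \<longleftrightarrow>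
      input_group x u = kernel_group x i"
    if "u < nverts x" "i < length ?L" for u i
  proof -
    have "kernel_group x i \<in> set (tree_groups ?a)"
      unfolding kernel_group_image[symmetric] using that(2) by (simp add: kernel_simps(1))
    then obtain S where S: "S \<in> groups x" "kernel_group x i = enc_set S"
      unfolding tree_groups_enc(2)[OF x] by blast
    have "set (list_of_tree (enc_set S)) = enc_nat ` S"
      using groups_partition(3)[OF x S(1)] by (simp add: list_of_enc_set)
    then show ?thesis
      using input_group_iff[OF x S(1) that(1)] S(2) by (auto simp: kernel_group_def)
  qed
  have sel: "sel (enc_set e) \<longleftrightarrow> input_group x ` e \<in> (`) (kernel_group x) ` M"
      if e: "e \<in> edges x" for e
  proof -
    obtain u v where uv: "e = {u, v}" "u < v"
      using edge_ordered[OF cp_graphD(1)[OF x] e] by blast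
    have V: "u < nverts x" "v < nverts x"
      using simple_graph_edge[OF cp_graphD(1)[OF x]] e uv(1) by blast+
    have enc: "hd_tree (enc_set e) = enc_nat u" "hd_tree (tl_tree (enc_set e)) = enc_nat v"
      by (simp_all add: uv enc_set_doubleton)
    show ?thesis
    proof
      assume "sel (enc_set e)"
      then obtain f i j where f: "f \<in> M" "i < length ?L" "j < length ?L" "enc_set f =
          Pr (enc_nat i) (Pr (enc_nat j) Nl)"
          "input_group x u = kernel_group x i \<and> input_group x v = kernel_group x j \<or>
           input_group x u = kernel_group x j \<and> input_group x v = kernel_group x i"
        unfolding sel_def enc set_list_of_enc_family[OF finM] by (auto simp: mem V)
      obtain p q where "f = {p, q}" "p < q"
        using edge_ordered[OF simple_graph_kernel] f(1) M by blast
      then have "f = {i, j}"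
        using f(4) by (simp add: enc_set_doubleton)
      then have "input_group x ` e = kernel_group x ` f"
        using f(5) uv(1) by (elim disjE) (simp_all add: insert_commute)
      then show "input_group x ` e \<in> (`) (kernel_group x) ` M"
        using f(1) by blast
    next
      assume "input_group x ` e \<in> (`) (kernel_group x) ` M"
      then obtain f where f: "f \<in> M" "input_group x ` e = kernel_group x ` f"
        by blast
      obtain i j where ij: "f = {i, j}" "i < j"
        using edge_ordered[OF simple_graph_kernel] f(1) M by blast
      have bounds: "i < length ?L" "j < length ?L"
        using f(1) M kernel_edge_iff[of i j x] ij(1) kernel_simps(1) by auto
      have "input_group x u = kernel_group x i \<and> input_group x v = kernel_group x j \<or>
           input_group x u = kernel_group x j \<and> input_group x v = kernel_group x i"
        using f(2) uv(1) ij(1) by (simp add: doubleton_eq_iff)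
      moreover have "enc_set f \<in> set (list_of_tree (enc_family M))"
        using set_list_of_enc_family[OF finM] f(1) by blast
      moreover have "enc_set f = Pr (enc_nat i) (Pr (enc_nat j) Nl)"
        by (simp add: ij enc_set_doubleton)
      ultimately show "sel (enc_set e)"
        unfolding sel_def enc using V bounds
        by (intro bexI[of _ "enc_set f"] exI[of _ i] exI[of _ j] conjI) (simp_all add: mem)
    qed
  qed
  have "enc_family (lift_cut x M) = enc_list (enc_list enc_nat) (filter (\<lambda>ys. sel (enc_list
      enc_nat ys)) es)"
  proof (rule enc_family_eqI)
    show "sorted_wrt (<) (filter (\<lambda>ys. sel (enc_list enc_nat ys)) es)"
      unfolding es_def by (intro sorted_wrt_filter strict_sorted_list_of_set)
    have "lift_cut x M = {e \<in> edges x. sel (enc_set e)}"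
      unfolding lift_cut_def transfer_cut_def using sel by (intro Collect_cong) auto
    then show "set (filter (\<lambda>ys. sel (enc_list enc_nat ys)) es) = sorted_list_of_set ` lift_cut x M"
      by (auto simp: es enc_set_def)
  qed
  also have "\<dots> = tree_of_list (filter sel (tree_edges ?a))"
    unfolding enc_list_conv_map[of "enc_list enc_nat"] edges by (simp add: filter_map comp_def)
  finally show ?thesis
    unfolding lift_edges_def sel_def .
qed

section \<open>Sizes of encodings\<close>

lemma tsize_enc_family:
  assumes "finite F" "\<And>A. A \<in> F \<Longrightarrow> finite A"
  shows "tsize (enc_family F) = 1 + (\<Sum>A\<in>F. 1 + tsize (enc_set A))"
proof -
  have inj: "inj_on sorted_list_of_set F"
    by (intro inj_onI) (metis assms(2) set_sorted_list_of_set)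
  have "tsize (enc_family F) = 1 + (\<Sum>ys\<in>sorted_list_of_set ` F. 1 + tsize (enc_list enc_nat ys))"
    unfolding enc_family_def tsize_enc_list[of "enc_list enc_nat"]
    using assms(1) by (subst sum_list_distinct_conv_sum_set) simp_all
  then show ?thesis
    by (simp add: sum.reindex[OF inj] enc_set_def)
qed

text \<open>A vertex v costs 2v + 1 nodes in unary and one more node of the list.\<close>

lemma tsize_enc_set_le:
  assumes "A \<subseteq> {..<n}"
  shows "tsize (enc_set A) \<le> 1 + n * (2 * n + 2)"
proof -
  have "finite A" using assms finite_subset by blast
  then have "tsize (enc_set A) = 1 + (\<Sum>v\<in>A. 2 * v + 2)"
    unfolding enc_set_def tsize_enc_list by (subst sum_list_distinct_conv_sum_set) simp_all
  also have "(\<Sum>v\<in>A. 2 * v + 2) \<le> (\<Sum>v\<in>A. 2 * n + 2)"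
    using assms by (intro sum_mono) auto
  also have "\<dots> \<le> n * (2 * n + 2)"
    using card_mono[OF _ assms] by (simp del: mult_Suc_right)
  finally show ?thesis by simp
qed

lemma tsize_enc_family_le:
  assumes "F \<subseteq> Pow {..<n}" "card F \<le> m"
  shows "tsize (enc_family F) \<le> 1 + m * (2 + n * (2 * n + 2))"
proof -
  have sub: "A \<subseteq> {..<n}" if "A \<in> F" for A
    using assms(1) that by blast
  have fin: "finite F" "\<And>A. A \<in> F \<Longrightarrow> finite A"
    using finite_subset[OF assms(1)] finite_subset[OF sub] by simp_all
  have "1 + tsize (enc_set A) \<le> 2 + n * (2 * n + 2)" if "A \<in> F" for A
    using tsize_enc_set_le[OF sub[OF that]] by simp
  then have "(\<Sum>A\<in>F. 1 + tsize (enc_set A)) \<le> (\<Sum>A\<in>F. 2 + n * (2 * n + 2))"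
    by (rule sum_mono)
  also have "\<dots> \<le> m * (2 + n * (2 * n + 2))"
    using assms(2) unfolding sum_constant of_nat_id by (rule mult_le_mono1)
  finally show ?thesis
    using tsize_enc_family[OF fin] by simp
qed

text \<open>Bounds the encoding of a solution by that of the kernel edges; the lifting program reads
  the solution, but its time bound does not mention it.\<close>

lemma tsize_enc_family_mono:
  assumes "F \<subseteq> G" "finite G" "\<And>A. A \<in> G \<Longrightarrow> finite A"
  shows "tsize (enc_family F) \<le> tsize (enc_family G)"
proof -
  have "finite F"
    using assms finite_subset by blast
  then have "tsize (enc_family F) = 1 + (\<Sum>A\<in>F. 1 + tsize (enc_set A))"
    using assms by (intro tsize_enc_family) auto
  also have "\<dots> \<le> 1 + (\<Sum>A\<in>G. 1 + tsize (enc_set A))"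
    using assms(1,2) by (intro add_left_mono sum_mono2) auto
  also have "\<dots> = tsize (enc_family G)"
    using assms(2,3) by (rule tsize_enc_family[symmetric])
  finally show ?thesis .
qed

text \<open>The constant 7 counts three pairing nodes and one closing \<open>Nl\<close> for each of
  the four components. The number of edges is bounded by that of ordered pairs.\<close>

lemma enc_cp_graph_size_le:
  assumes x: "x \<in> cp_graphs" and n: "nverts x \<le> n"
  shows "tsize (enc_cp_graph x) \<le> 7 + 2 * n + n * n * (2 + n * (2 * n + 2)) + bound x * (2 + n *
      (2 * n + 2)) + 2 * bound x"
proof -
  have sub: "{..<nverts x} \<subseteq> {..<n}" using n by auto
  have "edges x \<subseteq> (\<lambda>(u, v). {u, v}) ` ({..<n} \<times> {..<n})"
  proof
    fix e assume "e \<in> edges x"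
    then obtain u v where "e = {u, v}" "u \<in> {..<nverts x}" "v \<in> {..<nverts x}"
      by (rule simple_graph_edgeE[OF cp_graphD(1)[OF x]])
    then show "e \<in> (\<lambda>(u, v). {u, v}) ` ({..<n} \<times> {..<n})"
      using sub by (intro image_eqI[of _ _ "(u, v)"]) auto
  qed
  then have "card (edges x) \<le> card ((\<lambda>(u, v). {u, v}) ` ({..<n} \<times> {..<n}))"
    by (rule card_mono[rotated]) simp
  also have "\<dots> \<le> card ({..<n} \<times> {..<n})"
    by (rule card_image_le) simp
  finally have "card (edges x) \<le> n * n"
    by (simp add: card_cartesian_product)
  moreover have "e \<subseteq> {..<n}" if "e \<in> edges x" for e
    using cp_graphD(1)[OF x] that sub order_trans[of e "{..<nverts x}" "{..<n}"]
        by (simp add: simple_graph_def)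
  then have "edges x \<subseteq> Pow {..<n}"
    by auto
  ultimately have "tsize (enc_family (edges x)) \<le> 1 + n * n * (2 + n * (2 * n + 2))"
    by (rule tsize_enc_family_le[rotated])
  moreover have "cliques x \<subseteq> Pow {..<n}"
    using partition_onD1[OF cp_graphD(2)[OF x]] sub by auto
  then have "tsize (enc_family (cliques x)) \<le> 1 + bound x * (2 + n * (2 * n + 2))"
    using cp_graphD(4)[OF x] by (rule tsize_enc_family_le)
  moreover have "tsize (enc_cp_graph x) =
      3 + (2 * nverts x + 1) + tsize (enc_family (edges x)) + tsize (enc_family (cliques x)) + (2 *
          bound x + 1)"
    by (simp add: enc_cp_graph_def)
  ultimately show ?thesis
    using n by linarith
qed

section \<open>Computability of the size bound, and the three kernels\<close>

definition ptime_nat :: "(nat \<Rightarrow> nat) \<Rightarrow> bool" where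
  "ptime_nat f \<longleftrightarrow> (\<exists>F. ptime F \<and> (\<forall>n. F (enc_nat n) = enc_nat (f n)))"

lemma ptime_nat_computable: "ptime_nat f \<Longrightarrow> computable f"
  unfolding ptime_nat_def computable_def ptime_def by metis

lemma ptime_nat_const: "ptime_nat (\<lambda>n. m)"
  unfolding ptime_nat_def using ptime_const by blast

lemma ptime_nat_id: "ptime_nat (\<lambda>n. n)"
  unfolding ptime_nat_def using ptime_id by blast

lemma ptime_nat_add:
  assumes "ptime_nat f" "ptime_nat g"
  shows "ptime_nat (\<lambda>n. f n + g n)"
proof -
  obtain F G where FG: "ptime F" "\<And>n. F (enc_nat n) =
      enc_nat (f n)" "ptime G" "\<And>n. G (enc_nat n) = enc_nat (g n)"
    using assms unfolding ptime_nat_def by metis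
  have "ptime (\<lambda>a. tree_of_list (list_of_tree (F a) @ list_of_tree (G a)))"
    by (intro ptime_append ptime_list_of_tree FG)
  then show ?thesis
    unfolding ptime_nat_def
    by (intro exI[of _ "\<lambda>a. tree_of_list (list_of_tree (F a) @ list_of_tree (G a))"] conjI allI)
      (simp_all only: FG list_of_enc_nat replicate_add[symmetric] tree_of_replicate)
qed

text \<open>A product in unary is one copy of the second factor for each entry of the first.\<close>

lemma ptime_nat_mult:
  assumes "ptime_nat f" "ptime_nat g"
  shows "ptime_nat (\<lambda>n. f n * g n)"
proof -
  obtain F G where FG: "ptime F" "\<And>n. F (enc_nat n) =
      enc_nat (f n)" "ptime G" "\<And>n. G (enc_nat n) = enc_nat (g n)"
    using assms unfolding ptime_nat_def by metis
  have "ptime (\<lambda>a. tree_of_list (concat (map (\<lambda>_. list_of_tree (G a)) (list_of_tree (F a)))))"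
    by (intro ptime_concat ptime_list_of_tree FG ptime_comp[OF FG(3)] ptime_intros)
  moreover have "concat (map (\<lambda>_. list_of_tree (enc_nat m)) (list_of_tree (enc_nat n))) =
      replicate (n * m) Nl" for m n
    by (induction n) (simp_all add: replicate_add)
  ultimately show ?thesis
    unfolding ptime_nat_def
    by (intro exI[of _ "\<lambda>a. tree_of_list (concat (map (\<lambda>_. list_of_tree (G a))
        (list_of_tree (F a))))"] conjI allI)
      (simp_all only: FG tree_of_replicate)
qed

text \<open>Treats the three problems at once. Inclusion in the matching cuts makes each solution a
  set of kernel edges, which bounds its encoding and allows \<open>enc_lift_cut\<close> to
  apply.\<close>

lemma cp_problem_kernel:
  assumes S: "\<And>V E. S V E \<subseteq> matching_cuts V E"
    and bij: "\<And>x. x \<in> cp_graphs \<Longrightarrow>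
      bij_betw (lift_cut x) (S {..<nverts (kernel x)} (edges (kernel x))) (S {..<nverts x} (edges x))"
  shows "bijective_enum_kernel (cp_problem S) kernel lift_cut"
proof -
  have Q: "instances (cp_problem S) = cp_graphs" "sols (cp_problem S) x = S {..<nverts x} (edges x)"
      "param (cp_problem S) = bound" "enc_inst (cp_problem S) =
          enc_cp_graph" "enc_sol (cp_problem S) = enc_family"
      "inst_size (cp_problem S) x = tsize (enc_cp_graph x)" for x
    by (simp_all add: cp_problem_def inst_size_def)
  have red: "\<exists>p (q :: nat poly). \<forall>x\<in>cp_graphs. \<exists>t \<le> poly q (tsize
      (enc_cp_graph x) + bound x).
      exec p (enc_cp_graph x) t (enc_cp_graph (kernel x))"
  proof -
    obtain p and q :: "nat poly" where p: "\<And>a. \<exists>t \<le> poly q (tsize a). exec p a t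
        (kernel_tree a)"
      using ptime_kernel_tree unfolding ptime_def by blast
    have "\<exists>t \<le> poly q (tsize (enc_cp_graph x) + bound x). exec p (enc_cp_graph x) t
        (enc_cp_graph (kernel x))" for x
      using p[of "enc_cp_graph x"] poly_nat_mono[of "tsize (enc_cp_graph x)"
          "tsize (enc_cp_graph x) + bound x" q]
      unfolding enc_kernel by (meson le_add1 le_trans)
    then show ?thesis by blast
  qed
  have size: "\<exists>f. computable f \<and> (\<forall>x\<in>cp_graphs. tsize (enc_cp_graph (kernel
      x)) + bound (kernel x) \<le> f (bound x))"
  proof -
    \<comment> \<open>The vertex bound 32 k^3, written with binary products to suit
      \<open>ptime_nat_mult\<close>.\<close>
    define n where "n = (\<lambda>k :: nat. 32 * (k * (k * k)))"
    define f where "f = (\<lambda>k. 7 + 2 * n k + n k * n k * (2 + n k * (2 * n k + 2)) +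
      (2 * k) * (2 + n k * (2 * n k + 2)) + 2 * (2 * k) + 2 * k)"
    have "ptime_nat f"
      unfolding f_def n_def by (intro ptime_nat_add ptime_nat_mult ptime_nat_const ptime_nat_id)
    moreover have "tsize (enc_cp_graph (kernel x)) + bound (kernel x) \<le> f (bound x)"
        if x: "x \<in> cp_graphs" for x
    proof -
      have "nverts (kernel x) \<le> n (bound x)"
        using nverts_kernel_le[OF x] by (simp add: n_def power3_eq_cube mult.assoc)
      from enc_cp_graph_size_le[OF kernel_in_cp_graphs[OF x] this] show ?thesis
        unfolding f_def kernel_simps(4) by linarith
    qed
    ultimately show ?thesis
      using ptime_nat_computable by blast
  qed
  have lift: "\<exists>p (q :: nat poly). \<forall>x\<in>cp_graphs. \<forall>s\<in>S {..<nverts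
      (kernel x)} (edges (kernel x)).
      \<exists>t \<le> poly q (tsize (enc_cp_graph x) + tsize (enc_cp_graph (kernel x)) + bound x +
          bound (kernel x)).
        exec p (Pr (enc_cp_graph x) (Pr (enc_cp_graph (kernel x)) (enc_family s))) t (enc_family
            (lift_cut x s))"
  proof -
    have "ptime (\<lambda>a. tree_of_list (lift_edges (hd_tree a) (tl_tree (tl_tree a))))"
      by (intro ptime_lift_edges ptime_intros)
    then obtain p and q :: "nat poly" where
      p: "\<And>a. \<exists>t \<le> poly q (tsize a). exec p a t (tree_of_list (lift_edges (hd_tree
          a) (tl_tree (tl_tree a))))"
      unfolding ptime_def by blast
    \<comment> \<open>The input of the lifting program also contains \<open>s\<close>. Together with
      the two pairing nodes, \<open>s\<close> is no larger than the kernel encoding, so doubling the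
      argument of \<open>q\<close> is enough.\<close>
    have "\<exists>t \<le> poly (pcompose q [:0, 2:]) (tsize (enc_cp_graph x) + tsize (enc_cp_graph
        (kernel x)) + bound x + bound (kernel x)).
        exec p (Pr (enc_cp_graph x) (Pr (enc_cp_graph (kernel x)) (enc_family s))) t (enc_family
            (lift_cut x s))"
      if x: "x \<in> cp_graphs" and s: "s \<in> S {..<nverts (kernel x)} (edges (kernel x))" for x s
    proof -
      let ?i = "Pr (enc_cp_graph x) (Pr (enc_cp_graph (kernel x)) (enc_family s))"
      have sE: "s \<subseteq> edges (kernel x)"
        using s S unfolding matching_cuts_def edges_between_def by blast
      have "tsize (enc_family s) \<le> tsize (enc_family (edges (kernel x)))"
        using cp_graphD(7,8)[OF kernel_in_cp_graphs[OF x]] by (intro tsize_enc_family_mono sE)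
      also have "\<dots> + 2 \<le> tsize (enc_cp_graph (kernel x))"
        using tsize_pos[of "enc_family (cliques (kernel x))"] by (simp add: enc_cp_graph_def)
      finally have "tsize ?i \<le> 2 * (tsize (enc_cp_graph x) + tsize (enc_cp_graph (kernel x)) +
          bound x + bound (kernel x))"
        by simp
      then have "poly q (tsize ?i) \<le> poly (pcompose q [:0, 2:]) (tsize (enc_cp_graph x) + tsize
          (enc_cp_graph (kernel x)) + bound x + bound (kernel x))"
        by (simp add: poly_pcompose poly_nat_mono mult.commute)
      then show ?thesis
        using p[of ?i] enc_lift_cut[OF x sE] by (auto intro: le_trans)
    qed
    then show ?thesis by blast
  qed
  show ?thesis
    unfolding bijective_enum_kernel_def Q using kernel_in_cp_graphs red size lift bij by blast
qed

theorem theorem32: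
  shows "\<forall>Q\<in>{Enum_MC, Enum_Minimal_MC, Enum_Maximal_MC}.
    \<exists>red lift. bijective_enum_kernel Q red lift \<and>
      (\<exists>c::nat. \<forall>x\<in>instances Q. nverts (red x) \<le> c * param Q x ^ 3)"
proof -
  have "bijective_enum_kernel Q kernel lift_cut \<and>
      (\<forall>x\<in>instances Q. nverts (kernel x) \<le> 32 * param Q x ^ 3)"
    if "Q \<in> {Enum_MC, Enum_Minimal_MC, Enum_Maximal_MC}" for Q
  proof
    show "bijective_enum_kernel Q kernel lift_cut"
      using that unfolding Enum_MC_def Enum_Minimal_MC_def Enum_Maximal_MC_def
      by (elim insertE emptyE; simp only:)
        (rule cp_problem_kernel; use lift_cut_bij in \<open>auto simp: minimal_matching_cuts_def
            maximal_matching_cuts_def\<close>)+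
    have "instances Q = cp_graphs" "param Q = bound"
      using that by (auto simp: Enum_MC_def Enum_Minimal_MC_def Enum_Maximal_MC_def cp_problem_def)
    then show "\<forall>x\<in>instances Q. nverts (kernel x) \<le> 32 * param Q x ^ 3"
      using nverts_kernel_le by simp
  qed
  then show ?thesis by blast
qed

end
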